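(* Let $G_1=(V_1,E_1)$ and $G_2=(V_2,E_2)$ be simple graphs. Then $$\mathcal A(\mathrm{HypIso}(G_1,G_2))\;\cong\;\mathcal A(\mathrm{Iso}(G_1,G_2))\big/\big\langle\,u_{v_1,v_2}u_{w_1,w_2}-u_{w_1,w_2}u_{v_1,v_2}\;:\;v_1\sim_{G_1}w_1,\ v_2\sim_{G_2}w_2\,\big\rangle .$$
   Context: Algebras are over $\mathbb C$. A hypergraph $\Lambda=(V,E)$ consists of a finite set $V$ and a finite non-empty family $E$ of hyperedges, each identified with a subset of $V$; all hypergraphs are assumed full (every vertex lies in some hyperedge). Its incidence matrix $A_\Lambda$ is the $V\times E$ matrix with entry $1$ at $(v,e)$ if $v\in e$, and $0$ otherwise. A (finite) simple graph $G=(V,E)$ is regarded as a hypergraph whose hyperedges are its edges (two-element subsets of $V$); $A^{(G)}$ is its adjacency matrix and $\sim_G$ denotes adjacency. A magic unitary over a unital $*$-algebra is a matrix $(p_{i,j})$ with $p_{i,j}=p_{i,j}^*=p_{i,j}^2$, all rows and all columns summing to $1$, $p_{i,j}p_{i,j'}=0$ for $j\ne j'$ and $p_{i,j}p_{i',j}=0$ for $i\neq i'$. $\mathcal A(\mathrm{Iso}(G_1,G_2))$ (the $*$-algebra of the graph isomorphism game) is the universal unital $*$-algebra generated by the entries of a magic unitary $U=(u_{v_1,v_2})_{v_1\in V_1,v_2\in V_2}$ with $A^{(G_1)}U=UA^{(G_2)}$. $\mathcal A(\mathrm{HypIso}(\Lambda_1,\Lambda_2))$ (the $*$-algebra of the hypergraph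 isomorphism game), for hypergraphs $\Lambda_i=(V_i,E_i)$, is the universal unital $*$-algebra generated by the entries of two magic unitaries $P_V=(p_{v_1,v_2})_{v_1\in V_1,v_2\in V_2}$, $P_E=(p_{e_1,e_2})_{e_1\in E_1,e_2\in E_2}$ with $A_{\Lambda_1}P_E=P_VA_{\Lambda_2}$. $\langle\cdot\rangle$ denotes the two-sided $*$-ideal generated by the indicated elements; the isomorphism is the canonical one with $u_{v_1,v_2}$ corresponding to $p_{v_1,v_2}$. *)

theory Defs
  imports Complex_Main "HOL-Algebra.QuotRing" "HOL-Algebra.Module"
begin

section \<open>Unital star-algebras over the complex numbers\<close>

record 'a star_alg = "(complex, 'a) module" +
  star :: "'a \<Rightarrow> 'a"

locale star_algebra = ring A for A (structure) +
  assumes smult_closed: "x \<in> carrier A \<Longrightarrow> c \<odot> x \<in> carrier A"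
    and smult_l_distr: "x \<in> carrier A \<Longrightarrow> (c + d) \<odot> x = (c \<odot> x) \<oplus> (d \<odot> x)"
    and smult_r_distr:
      "\<lbrakk>x \<in> carrier A; y \<in> carrier A\<rbrakk> \<Longrightarrow> c \<odot> (x \<oplus> y) = (c \<odot> x) \<oplus> (c \<odot> y)"
    and smult_smult: "x \<in> carrier A \<Longrightarrow> (c * d) \<odot> x = c \<odot> (d \<odot> x)"
    and smult_one: "x \<in> carrier A \<Longrightarrow> 1 \<odot> x = x"
    and smult_mult_left:
      "\<lbrakk>x \<in> carrier A; y \<in> carrier A\<rbrakk> \<Longrightarrow> (c \<odot> x) \<otimes> y = c \<odot> (x \<otimes> y)"
    and smult_mult_right:
      "\<lbrakk>x \<in> carrier A; y \<in> carrier A\<rbrakk> \<Longrightarrow> x \<otimes> (c \<odot> y) = c \<odot> (x \<otimes> y)"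
    and star_closed: "x \<in> carrier A \<Longrightarrow> star A x \<in> carrier A"
    and star_star: "x \<in> carrier A \<Longrightarrow> star A (star A x) = x"
    and star_add:
      "\<lbrakk>x \<in> carrier A; y \<in> carrier A\<rbrakk> \<Longrightarrow> star A (x \<oplus> y) = star A x \<oplus> star A y"
    and star_smult: "x \<in> carrier A \<Longrightarrow> star A (c \<odot> x) = cnj c \<odot> star A x"
    and star_mult:
      "\<lbrakk>x \<in> carrier A; y \<in> carrier A\<rbrakk> \<Longrightarrow> star A (x \<otimes> y) = star A y \<otimes> star A x"

definition star_alg_iso ::
    "('a, 'c) star_alg_scheme \<Rightarrow> ('b, 'd) star_alg_scheme \<Rightarrow> ('a \<Rightarrow> 'b) set" where
  "star_alg_iso A B = {\<phi> \<in> ring_iso A B. \<forall>x\<in>carrier A.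
     (\<forall>c. \<phi> (c \<odot>\<^bsub>A\<^esub> x) = c \<odot>\<^bsub>B\<^esub> \<phi> x) \<and> \<phi> (star A x) = star B (\<phi> x)}"

text \<open>In a unital algebra every two-sided ring ideal is closed under scalar multiplication,
  since a scalar multiple of x is (c 1) x.\<close>

definition star_ideal :: "'a set \<Rightarrow> ('a, 'c) star_alg_scheme \<Rightarrow> bool" where
  "star_ideal I A \<longleftrightarrow> ideal I A \<and> (\<forall>x\<in>I. star A x \<in> I)"

definition star_idl :: "('a, 'c) star_alg_scheme \<Rightarrow> 'a set \<Rightarrow> 'a set" where
  "star_idl A S = \<Inter>{I. star_ideal I A \<and> S \<subseteq> I}"

text \<open>The ring part agrees with \<^const>\<open>FactRing\<close>; scalar multiplication and star are
  defined on cosets in the style of \<^const>\<open>rcoset_mult\<close>.\<close>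

definition star_quot :: "('a, 'c) star_alg_scheme \<Rightarrow> 'a set \<Rightarrow> 'a set star_alg" where
  "star_quot A I =
    \<lparr>carrier = a_rcosets\<^bsub>A\<^esub> I, mult = rcoset_mult A I,
     one = I +>\<^bsub>A\<^esub> \<one>\<^bsub>A\<^esub>, zero = I, add = set_add A,
     smult = (\<lambda>c X. \<Union>x\<in>X. I +>\<^bsub>A\<^esub> (c \<odot>\<^bsub>A\<^esub> x)),
     star = (\<lambda>X. \<Union>x\<in>X. I +>\<^bsub>A\<^esub> star A x)\<rparr>"


section \<open>Star-algebras given by generators and relations\<close>

text \<open>The free unital star-algebra on \<open>X\<close>: finitely supported complex functions on words in
  the letters \<open>(x, False)\<close>, standing for x, and \<open>(x, True)\<close>, standing for its
  adjoint, with the convolution product.\<close>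

type_synonym 'x free_elem = "('x \<times> bool) list \<Rightarrow> complex"

definition word_star :: "('x \<times> bool) list \<Rightarrow> ('x \<times> bool) list" where
  "word_star w = rev (map (\<lambda>(x, b). (x, \<not> b)) w)"

definition free_star_alg :: "'x set \<Rightarrow> 'x free_elem star_alg" where
  "free_star_alg X =
    \<lparr>carrier = {a. finite {w. a w \<noteq> 0} \<and> {w. a w \<noteq> 0} \<subseteq> lists (X \<times> UNIV)},
     mult = (\<lambda>a b w. \<Sum>i\<le>length w. a (take i w) * b (drop i w)),
     one = (\<lambda>w. if w = [] then 1 else 0),
     zero = (\<lambda>w. 0),
     add = (\<lambda>a b w. a w + b w),
     smult = (\<lambda>c a w. c * a w),
     star = (\<lambda>a w. cnj (a (word_star w)))\<rparr>"

definition free_gen :: "'x \<Rightarrow> 'x free_elem" where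
  "free_gen x = (\<lambda>w. if w = [(x, False)] then 1 else 0)"

text \<open>A set of relations is a set of pairs \<open>(a, b)\<close>, each standing for the equation
  \<open>a = b\<close>.\<close>

definition rel_ideal :: "'x set \<Rightarrow> ('x free_elem \<times> 'x free_elem) set \<Rightarrow> 'x free_elem set" where
  "rel_ideal X R =
     star_idl (free_star_alg X) {a \<ominus>\<^bsub>free_star_alg X\<^esub> b | a b. (a, b) \<in> R}"

definition presented_star_alg ::
    "'x set \<Rightarrow> ('x free_elem \<times> 'x free_elem) set \<Rightarrow> 'x free_elem set star_alg" where
  "presented_star_alg X R = star_quot (free_star_alg X) (rel_ideal X R)"

definition presented_gen ::
    "'x set \<Rightarrow> ('x free_elem \<times> 'x free_elem) set \<Rightarrow> 'x \<Rightarrow> 'x free_elem set" where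
  "presented_gen X R x = rel_ideal X R +>\<^bsub>free_star_alg X\<^esub> free_gen x"

definition magic_unitary_rels ::
    "('a, 'c) star_alg_scheme \<Rightarrow> 'i set \<Rightarrow> 'j set \<Rightarrow> ('i \<Rightarrow> 'j \<Rightarrow> 'a) \<Rightarrow> ('a \<times> 'a) set" where
  "magic_unitary_rels A I J p =
     {(p i j, star A (p i j)) | i j. i \<in> I \<and> j \<in> J}
   \<union> {(p i j, p i j \<otimes>\<^bsub>A\<^esub> p i j) | i j. i \<in> I \<and> j \<in> J}
   \<union> {(\<Oplus>\<^bsub>A\<^esub>j\<in>J. p i j, \<one>\<^bsub>A\<^esub>) | i. i \<in> I}
   \<union> {(\<Oplus>\<^bsub>A\<^esub>i\<in>I. p i j, \<one>\<^bsub>A\<^esub>) | j. j \<in> J}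
   \<union> {(p i j \<otimes>\<^bsub>A\<^esub> p i j', \<zero>\<^bsub>A\<^esub>) | i j j'. i \<in> I \<and> j \<in> J \<and> j' \<in> J \<and> j \<noteq> j'}
   \<union> {(p i j \<otimes>\<^bsub>A\<^esub> p i' j, \<zero>\<^bsub>A\<^esub>) | i i' j. i \<in> I \<and> i' \<in> I \<and> j \<in> J \<and> i \<noteq> i'}"

text \<open>The matrix equation \<open>M P = Q N\<close>, entry by entry, for a complex \<open>I \<times> K\<close> matrix
  \<open>M\<close>, a complex \<open>L \<times> J\<close> matrix \<open>N\<close>, a \<open>K \<times> J\<close> matrix \<open>P\<close> and
  an \<open>I \<times> L\<close> matrix \<open>Q\<close> over \<open>A\<close>.\<close>

definition intertwiner_rels ::
    "('a, 'c) star_alg_scheme \<Rightarrow> 'i set \<Rightarrow> 'k set \<Rightarrow> 'l set \<Rightarrow> 'j set \<Rightarrow>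
     ('i \<Rightarrow> 'k \<Rightarrow> complex) \<Rightarrow> ('k \<Rightarrow> 'j \<Rightarrow> 'a) \<Rightarrow>
     ('i \<Rightarrow> 'l \<Rightarrow> 'a) \<Rightarrow> ('l \<Rightarrow> 'j \<Rightarrow> complex) \<Rightarrow> ('a \<times> 'a) set" where
  "intertwiner_rels A I K L J M P Q N =
     {(\<Oplus>\<^bsub>A\<^esub>k\<in>K. M i k \<odot>\<^bsub>A\<^esub> P k j, \<Oplus>\<^bsub>A\<^esub>l\<in>L. N l j \<odot>\<^bsub>A\<^esub> Q i l)
       | i j. i \<in> I \<and> j \<in> J}"


section \<open>Graphs and hypergraphs\<close>

text \<open>Hypergraphs are given by a vertex set and a set of subsets of it, so that a simple graph
  is literally a hypergraph. The hypergraph isomorphism algebra makes sense for arbitrary finite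
  \<open>V\<close> and \<open>E\<close>: that \<open>E\<close> be non-empty, or that every vertex lie in a
  hyperedge, is not required.\<close>

definition simple_graph :: "'v set \<Rightarrow> 'v set set \<Rightarrow> bool" where
  "simple_graph V E \<longleftrightarrow> finite V \<and> (\<forall>e\<in>E. e \<subseteq> V \<and> card e = 2)"

definition adjacent :: "'v set set \<Rightarrow> 'v \<Rightarrow> 'v \<Rightarrow> bool" where
  "adjacent E v w \<longleftrightarrow> {v, w} \<in> E"

definition adjacency_matrix :: "'v set set \<Rightarrow> 'v \<Rightarrow> 'v \<Rightarrow> complex" where
  "adjacency_matrix E v w = (if adjacent E v w then 1 else 0)"

definition incidence_matrix :: "'v \<Rightarrow> 'v set \<Rightarrow> complex" where
  "incidence_matrix v e = (if v \<in> e then 1 else 0)"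


section \<open>The algebras of the isomorphism games\<close>

definition iso_gens :: "'v set \<Rightarrow> 'w set \<Rightarrow> ('v \<times> 'w) set" where
  "iso_gens V1 V2 = V1 \<times> V2"

definition iso_rels :: "'v set \<Rightarrow> 'v set set \<Rightarrow> 'w set \<Rightarrow> 'w set set \<Rightarrow>
    (('v \<times> 'w) free_elem \<times> ('v \<times> 'w) free_elem) set" where
  "iso_rels V1 E1 V2 E2 =
    (let F = free_star_alg (iso_gens V1 V2);
         U = (\<lambda>v w. free_gen (v, w))
     in magic_unitary_rels F V1 V2 U
      \<union> intertwiner_rels F V1 V1 V2 V2 (adjacency_matrix E1) U U (adjacency_matrix E2))"

definition iso_alg :: "'v set \<Rightarrow> 'v set set \<Rightarrow> 'w set \<Rightarrow> 'w set set \<Rightarrow>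
    ('v \<times> 'w) free_elem set star_alg" where
  "iso_alg V1 E1 V2 E2 = presented_star_alg (iso_gens V1 V2) (iso_rels V1 E1 V2 E2)"

definition iso_u :: "'v set \<Rightarrow> 'v set set \<Rightarrow> 'w set \<Rightarrow> 'w set set \<Rightarrow>
    'v \<Rightarrow> 'w \<Rightarrow> ('v \<times> 'w) free_elem set" where
  "iso_u V1 E1 V2 E2 v w = presented_gen (iso_gens V1 V2) (iso_rels V1 E1 V2 E2) (v, w)"

type_synonym ('v, 'w) hyp_gen = "('v \<times> 'w) + ('v set \<times> 'w set)"

definition hyp_iso_gens :: "'v set \<Rightarrow> 'v set set \<Rightarrow> 'w set \<Rightarrow> 'w set set \<Rightarrow>
    ('v, 'w) hyp_gen set" where
  "hyp_iso_gens V1 E1 V2 E2 = (V1 \<times> V2) <+> (E1 \<times> E2)"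

definition hyp_iso_rels :: "'v set \<Rightarrow> 'v set set \<Rightarrow> 'w set \<Rightarrow> 'w set set \<Rightarrow>
    (('v, 'w) hyp_gen free_elem \<times> ('v, 'w) hyp_gen free_elem) set" where
  "hyp_iso_rels V1 E1 V2 E2 =
    (let F = free_star_alg (hyp_iso_gens V1 E1 V2 E2);
         PV = (\<lambda>v w. free_gen (Inl (v, w)));
         PE = (\<lambda>e f. free_gen (Inr (e, f)))
     in magic_unitary_rels F V1 V2 PV
      \<union> magic_unitary_rels F E1 E2 PE
      \<union> intertwiner_rels F V1 E1 V2 E2 incidence_matrix PE PV incidence_matrix)"

definition hyp_iso_alg :: "'v set \<Rightarrow> 'v set set \<Rightarrow> 'w set \<Rightarrow> 'w set set \<Rightarrow>
    ('v, 'w) hyp_gen free_elem set star_alg" where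
  "hyp_iso_alg V1 E1 V2 E2 =
     presented_star_alg (hyp_iso_gens V1 E1 V2 E2) (hyp_iso_rels V1 E1 V2 E2)"

definition hyp_iso_p :: "'v set \<Rightarrow> 'v set set \<Rightarrow> 'w set \<Rightarrow> 'w set set \<Rightarrow>
    'v \<Rightarrow> 'w \<Rightarrow> ('v, 'w) hyp_gen free_elem set" where
  "hyp_iso_p V1 E1 V2 E2 v w =
     presented_gen (hyp_iso_gens V1 E1 V2 E2) (hyp_iso_rels V1 E1 V2 E2) (Inl (v, w))"

definition edge_commutators :: "'v set \<Rightarrow> 'v set set \<Rightarrow> 'w set \<Rightarrow> 'w set set \<Rightarrow>
    ('v \<times> 'w) free_elem set set" where
  "edge_commutators V1 E1 V2 E2 =
    (let A = iso_alg V1 E1 V2 E2; u = iso_u V1 E1 V2 E2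
     in {(u v1 v2 \<otimes>\<^bsub>A\<^esub> u w1 w2) \<ominus>\<^bsub>A\<^esub> (u w1 w2 \<otimes>\<^bsub>A\<^esub> u v1 v2)
          | v1 w1 v2 w2. adjacent E1 v1 w1 \<and> adjacent E2 v2 w2})"


section \<open>The constructions yield unital star-algebras\<close>


lemma word_star_simps [simp]:
  "word_star [] = []" "word_star (word_star w) = w" "length (word_star w) = length w"
  "word_star w = [] \<longleftrightarrow> w = []"
  "take i (word_star w) = word_star (drop (length w - i) w)"
  "drop i (word_star w) = word_star (take (length w - i) w)"
  by (auto simp: word_star_def rev_map comp_def case_prod_beta take_rev drop_rev take_map drop_map)

lemma word_star_in_lists [simp]: "word_star w \<in> lists (X \<times> UNIV) \<longleftrightarrow> w \<in> lists (X \<times> UNIV)"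
  by (auto simp: word_star_def in_lists_conv_set case_prod_beta; force)

lemma carrier_freeI:
  "finite S \<Longrightarrow> S \<subseteq> lists (X \<times> UNIV) \<Longrightarrow> (\<And>w. w \<notin> S \<Longrightarrow> a w = 0) \<Longrightarrow>
   a \<in> carrier (free_star_alg X)"
  by (auto simp: free_star_alg_def dest: finite_subset[rotated, of S "{w. a w \<noteq> 0}"])

lemma free_mult_closed:
  assumes "a \<in> carrier (free_star_alg X)" "b \<in> carrier (free_star_alg X)"
  shows "a \<otimes>\<^bsub>free_star_alg X\<^esub> b \<in> carrier (free_star_alg X)"
proof (rule carrier_freeI[where S = "(\<lambda>(u, v). u @ v) ` ({w. a w \<noteq> 0} \<times> {w. b w \<noteq> 0})"])
  show "finite ((\<lambda>(u, v). u @ v) ` ({w. a w \<noteq> 0} \<times> {w. b w \<noteq> 0}))"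
    "(\<lambda>(u, v). u @ v) ` ({w. a w \<noteq> 0} \<times> {w. b w \<noteq> 0}) \<subseteq> lists (X \<times> UNIV)"
    using assms by (fastforce simp: free_star_alg_def)+
  fix w assume w: "w \<notin> (\<lambda>(u, v). u @ v) ` ({w. a w \<noteq> 0} \<times> {w. b w \<noteq> 0})"
  have "a (take i w) * b (drop i w) = 0" for i
  proof (rule ccontr)
    assume "a (take i w) * b (drop i w) \<noteq> 0"
    then have "w = (\<lambda>(u, v). u @ v) (take i w, drop i w)"
      "(take i w, drop i w) \<in> {w. a w \<noteq> 0} \<times> {w. b w \<noteq> 0}" by auto
    with w show False by blast
  qed
  then show "(a \<otimes>\<^bsub>free_star_alg X\<^esub> b) w = 0"
    unfolding free_star_alg_def by (simp only: star_alg.simps module.simps ring.simps monoid.simps) (rule sum.neutral, blast)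
qed

lemma conv_assoc:
  fixes a b c :: "'x free_elem"
  shows "(\<Sum>i\<le>length w. (\<Sum>j\<le>length (take i w). a (take j (take i w)) * b (drop j (take i w))) * c (drop i w))
   = (\<Sum>i\<le>length w. a (take i w) * (\<Sum>j\<le>length (drop i w). b (take j (drop i w)) * c (drop j (drop i w))))"
proof -
  have "(\<Sum>i\<le>length w. (\<Sum>j\<le>length (take i w). a (take j (take i w)) * b (drop j (take i w))) * c (drop i w))
    = (\<Sum>(i,j)\<in>(SIGMA i:{..length w}. {..i}). a (take j w) * b (take (i - j) (drop j w)) * c (drop i w))"
    by (subst sum.Sigma[symmetric]) (auto simp: sum_distrib_right drop_take min_absorb1 min_absorb2 intro!: sum.cong)
  also have "\<dots> = (\<Sum>(i,j)\<in>(SIGMA i:{..length w}. {..length w - i}). a (take i w) * b (take j (drop i w)) * c (drop (i + j) w))"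
    by (rule sum.reindex_bij_witness[where i = "\<lambda>(i,j). (i + j, i)" and j = "\<lambda>(i,j). (j, i - j)"]) auto
  also have "\<dots> = (\<Sum>i\<le>length w. a (take i w) * (\<Sum>j\<le>length (drop i w). b (take j (drop i w)) * c (drop j (drop i w))))"
    by (subst sum.Sigma[symmetric]) (auto simp: sum_distrib_left add.commute mult.assoc intro!: sum.cong)
  finally show ?thesis .
qed

lemma conv_one:
  fixes a :: "'x free_elem"
  shows "(\<Sum>i\<le>length w. (if take i w = [] then 1 else 0) * a (drop i w)) = a w"
    "(\<Sum>i\<le>length w. a (take i w) * (if drop i w = [] then 1 else 0)) = a w"
proof -
  have "(\<Sum>i\<le>length w. (if take i w = [] then 1 else 0) * a (drop i w)) = (\<Sum>i\<le>length w. if i = 0 then a w else 0)"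
    by (rule sum.cong) (auto simp: take_eq_Nil)
  then show "(\<Sum>i\<le>length w. (if take i w = [] then 1 else 0) * a (drop i w)) = a w" by simp
  have "(\<Sum>i\<le>length w. a (take i w) * (if drop i w = [] then 1 else 0)) = (\<Sum>i\<le>length w. if i = length w then a w else 0)"
    by (rule sum.cong) auto
  then show "(\<Sum>i\<le>length w. a (take i w) * (if drop i w = [] then 1 else 0)) = a w" by simp
qed

lemma ring_free: "ring (free_star_alg X)"
proof (rule ringI)
  show "abelian_group (free_star_alg X)"
  proof (rule abelian_groupI)
    fix x y assume "x \<in> carrier (free_star_alg X)" "y \<in> carrier (free_star_alg X)"
    then show "x \<oplus>\<^bsub>free_star_alg X\<^esub> y \<in> carrier (free_star_alg X)"
      by (intro carrier_freeI[where S = "{w. x w \<noteq> 0} \<union> {w. y w \<noteq> 0}"])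
        (auto simp: free_star_alg_def)
  next
    fix x assume x: "x \<in> carrier (free_star_alg X)"
    then have "(\<lambda>w. - x w) \<in> carrier (free_star_alg X)"
      by (simp add: free_star_alg_def)
    then show "\<exists>y\<in>carrier (free_star_alg X). y \<oplus>\<^bsub>free_star_alg X\<^esub> x = \<zero>\<^bsub>free_star_alg X\<^esub>"
      by (rule bexI[rotated]) (simp add: free_star_alg_def)
  qed (auto simp: free_star_alg_def add_ac)
  show "Group.monoid (free_star_alg X)"
  proof (rule monoidI)
    show "\<one>\<^bsub>free_star_alg X\<^esub> \<in> carrier (free_star_alg X)"
      by (rule carrier_freeI[where S = "{[]}"]) (auto simp: free_star_alg_def)
    fix x y z :: "'a free_elem"
    show "x \<otimes>\<^bsub>free_star_alg X\<^esub> y \<otimes>\<^bsub>free_star_alg X\<^esub> z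
      = x \<otimes>\<^bsub>free_star_alg X\<^esub> (y \<otimes>\<^bsub>free_star_alg X\<^esub> z)"
      using conv_assoc[where a = x and b = y and c = z] by (intro ext) (simp only: free_star_alg_def monoid.simps)
    show "\<one>\<^bsub>free_star_alg X\<^esub> \<otimes>\<^bsub>free_star_alg X\<^esub> x = x"
      "x \<otimes>\<^bsub>free_star_alg X\<^esub> \<one>\<^bsub>free_star_alg X\<^esub> = x"
      using conv_one[where a = x] by (auto simp only: free_star_alg_def monoid.simps fun_eq_iff)
  qed (rule free_mult_closed)
qed (auto simp: free_star_alg_def algebra_simps sum.distrib)

lemma star_algebra_free: "star_algebra (free_star_alg X)"
proof -
  interpret ring "free_star_alg X" by (rule ring_free)
  show ?thesis
  proof
    fix x c assume x: "x \<in> carrier (free_star_alg X)"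
    then show "c \<odot>\<^bsub>free_star_alg X\<^esub> x \<in> carrier (free_star_alg X)"
      by (intro carrier_freeI[where S = "{w. x w \<noteq> 0}"]) (auto simp: free_star_alg_def)
    have "inj (word_star :: ('a \<times> bool) list \<Rightarrow> _)"
      by (metis injI word_star_simps(2))
    then have "finite (word_star -` {w. x w \<noteq> 0})"
      using x by (intro finite_vimageI) (auto simp: free_star_alg_def)
    then show "star (free_star_alg X) x \<in> carrier (free_star_alg X)"
    proof (rule carrier_freeI)
      have sub: "{w. x w \<noteq> 0} \<subseteq> lists (X \<times> UNIV)"
        using x by (simp only: free_star_alg_def partial_object.simps mem_Collect_eq)
      show "word_star -` {w. x w \<noteq> 0} \<subseteq> lists (X \<times> UNIV)"
      proof
        fix w assume "w \<in> word_star -` {w. x w \<noteq> 0}"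
        then have "word_star w \<in> lists (X \<times> UNIV)"
          using sub by blast
        then show "w \<in> lists (X \<times> UNIV)" by (simp only: word_star_in_lists)
      qed
    qed (auto simp: free_star_alg_def)
  next
    fix x y :: "'a free_elem"
    have "(\<Sum>i\<le>length w. cnj (x (word_star (drop (length w - i) w))) * cnj (y (word_star (take (length w - i) w))))
       = (\<Sum>i\<le>length w. cnj (x (word_star (drop i w))) * cnj (y (word_star (take i w))))" for w
      by (rule sum.reindex_bij_witness[where i = "\<lambda>i. length w - i" and j = "\<lambda>i. length w - i"]) auto
    then show "star (free_star_alg X) (x \<otimes>\<^bsub>free_star_alg X\<^esub> y)
      = star (free_star_alg X) y \<otimes>\<^bsub>free_star_alg X\<^esub> star (free_star_alg X) x"
      by (simp add: free_star_alg_def fun_eq_iff mult.commute)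
  qed (auto simp: free_star_alg_def algebra_simps sum_distrib_left)
qed

lemma (in star_algebra) star_ideal_star_idl:
  assumes "S \<subseteq> carrier A" shows "star_ideal (star_idl A S) A" "S \<subseteq> star_idl A S"
proof -
  have one: "star_ideal (carrier A) A"
    by (simp add: star_ideal_def oneideal star_closed)
  have "ideal (\<Inter>{I. star_ideal I A \<and> S \<subseteq> I}) A"
    using one assms by (intro i_Intersect) (auto simp: star_ideal_def)
  then show "star_ideal (star_idl A S) A"
    unfolding star_idl_def star_ideal_def by auto
  show "S \<subseteq> star_idl A S" by (auto simp: star_idl_def)
qed

lemma (in star_algebra) star_ideal_smult:
  assumes "ideal I A" "x \<in> I" shows "c \<odot> x \<in> I"
proof -
  interpret I: ideal I A by fact
  have x: "x \<in> carrier A" using assms(2) I.a_Hcarr by blast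
  have "(c \<odot> \<one>) \<otimes> x \<in> I"
    using assms(2) by (intro I.I_l_closed) (auto simp: smult_closed)
  then show ?thesis using x by (simp add: smult_mult_left)
qed

lemma (in star_algebra) star_quot_rep:
  assumes "star_ideal I A" "x \<in> carrier A"
  shows "c \<odot>\<^bsub>star_quot A I\<^esub> (I +> x) = I +> (c \<odot> x)"
    "star (star_quot A I) (I +> x) = I +> star A x"
proof -
  interpret I: ideal I A using assms(1) by (simp add: star_ideal_def)
  have el: "\<exists>h\<in>I. y = h \<oplus> x \<and> y \<in> carrier A" if "y \<in> I +> x" for y
    using that assms(2) I.a_Hcarr by (auto simp: a_r_coset_def r_coset_def)
  have eq: "I +> (h \<oplus> z) = I +> z" if "h \<in> I" "z \<in> carrier A" for h z
    using a_coset_add_assoc[OF I.a_subset I.a_Hcarr[OF that(1)] that(2)] I.a_rcos_const[OF that(1)] by simp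
  have self: "x \<in> I +> x" using assms(2) I.a_rcos_self by blast
  have rep: "I +> (c \<odot> y) = I +> (c \<odot> x)" "I +> star A y = I +> star A x" if y: "y \<in> I +> x" for y
  proof -
    obtain h where h: "h \<in> I" "y = h \<oplus> x" using el[OF y] by blast
    then have hc: "h \<in> carrier A" using I.a_Hcarr by blast
    have "c \<odot> h \<in> I" by (rule star_ideal_smult[OF I.ideal_axioms h(1)])
    then show "I +> (c \<odot> y) = I +> (c \<odot> x)"
      using h(2) hc assms(2) eq[of "c \<odot> h" "c \<odot> x"] by (simp add: smult_r_distr smult_closed)
    have "star A h \<in> I" using assms(1) h(1) by (simp add: star_ideal_def)
    then show "I +> star A y = I +> star A x"
      using h(2) hc assms(2) eq[of "star A h" "star A x"] by (simp add: star_add star_closed)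
  qed
  show "c \<odot>\<^bsub>star_quot A I\<^esub> (I +> x) = I +> (c \<odot> x)"
    unfolding star_quot_def module.simps by (rule UN_constant_eq[OF self], rule ballI, rule rep(1))
  show "star (star_quot A I) (I +> x) = I +> star A x"
    unfolding star_quot_def star_alg.simps by (rule UN_constant_eq[OF self], rule ballI, rule rep(2))
qed

lemma (in star_algebra) star_algebra_star_quot:
  assumes "star_ideal I A"
  shows "star_algebra (star_quot A I)"
proof -
  interpret I: ideal I A using assms by (simp add: star_ideal_def)
  let ?Q = "star_quot A I"
  interpret Q: ring "A Quot I" by (rule I.quotient_is_ring)
  have ops: "carrier ?Q = (+>) I ` carrier A"
    "\<And>x y. x \<in> carrier A \<Longrightarrow> y \<in> carrier A \<Longrightarrow> (I +> x) \<otimes>\<^bsub>?Q\<^esub> (I +> y) = I +> (x \<otimes> y)"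
    "\<And>x y. x \<in> carrier A \<Longrightarrow> y \<in> carrier A \<Longrightarrow> (I +> x) \<oplus>\<^bsub>?Q\<^esub> (I +> y) = I +> (x \<oplus> y)"
    by (auto simp: star_quot_def I.rcoset_mult_add I.a_rcos_sum A_RCOSETS_def RCOSETS_def a_r_coset_def[symmetric])
  have eq: "carrier ?Q = carrier (A Quot I)" "mult ?Q = mult (A Quot I)" "one ?Q = one (A Quot I)"
    "zero ?Q = zero (A Quot I)" "add ?Q = add (A Quot I)"
    by (auto simp: star_quot_def FactRing_def)
  have "ring ?Q"
  proof (rule ringI)
    show "abelian_group ?Q"
      by (rule abelian_groupI)
        (simp_all add: eq Q.a_ac Q.add.l_inv_ex)
    show "Group.monoid ?Q"
      by (rule monoidI) (auto simp: eq Q.m_assoc)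
  qed (auto simp: eq Q.l_distr Q.r_distr)
  then show ?thesis
    by (intro star_algebra.intro star_algebra_axioms.intro)
      (auto simp: ops star_quot_rep[OF assms] smult_closed star_closed smult_l_distr smult_r_distr
        smult_smult smult_one smult_mult_left smult_mult_right star_star star_add star_smult star_mult)
qed


lemma star_algebra_presented:
  assumes "R \<subseteq> carrier (free_star_alg X) \<times> carrier (free_star_alg X)"
  shows "star_algebra (presented_star_alg X R)"
proof -
  interpret star_algebra "free_star_alg X" by (rule star_algebra_free)
  show ?thesis unfolding presented_star_alg_def rel_ideal_def
    using assms by (intro star_algebra_star_quot star_ideal_star_idl) (auto intro!: minus_closed)
qed

lemma (in star_algebra) magic_carrier:
  assumes "\<And>i j. i \<in> I \<Longrightarrow> j \<in> J \<Longrightarrow> p i j \<in> carrier A"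
  shows "magic_unitary_rels A I J p \<subseteq> carrier A \<times> carrier A"
  using assms by (auto simp: magic_unitary_rels_def intro!: finsum_closed star_closed)

lemma (in star_algebra) intertwiner_carrier:
  assumes "\<And>k j. k \<in> K \<Longrightarrow> j \<in> J \<Longrightarrow> P k j \<in> carrier A"
    "\<And>i l. i \<in> I \<Longrightarrow> l \<in> L \<Longrightarrow> Q i l \<in> carrier A"
  shows "intertwiner_rels A I K L J M P Q N \<subseteq> carrier A \<times> carrier A"
  using assms by (auto simp: intertwiner_rels_def intro!: finsum_closed smult_closed)

lemma free_gen_closed: "x \<in> X \<Longrightarrow> free_gen x \<in> carrier (free_star_alg X)"
  by (rule carrier_freeI[where S = "{[(x, False)]}"]) (auto simp: free_gen_def)

lemma star_algebra_iso_alg: "star_algebra (iso_alg V1 E1 V2 E2)"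
proof -
  interpret star_algebra "free_star_alg (iso_gens V1 V2)" by (rule star_algebra_free)
  show ?thesis unfolding iso_alg_def iso_rels_def Let_def
    by (intro star_algebra_presented Un_least magic_carrier intertwiner_carrier free_gen_closed)
      (auto simp: iso_gens_def)
qed

lemma star_algebra_hyp_iso_alg: "star_algebra (hyp_iso_alg V1 E1 V2 E2)"
proof -
  interpret star_algebra "free_star_alg (hyp_iso_gens V1 E1 V2 E2)" by (rule star_algebra_free)
  show ?thesis unfolding hyp_iso_alg_def hyp_iso_rels_def Let_def
    by (intro star_algebra_presented Un_least magic_carrier intertwiner_carrier free_gen_closed)
      (auto simp: hyp_iso_gens_def)
qed

end

theory Submission
  imports Defs "HOL-Algebra.UnivPoly"
begin



text \<open>Both algebras are universal for a magic unitary \<open>u\<close> with further structure, so the isomorphism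
amounts to two translations between relations, each valid in an arbitrary unital star-algebra.
Throughout, \<open>v, w\<close> are vertices of the first graph, \<open>x, y\<close> vertices of the second, and
\<open>row v f\<close> is the projection \<open>\<Sum>x\<in>f. u v x\<close>.

The working form of the equation \<open>A\<^sub>1 u = u A\<^sub>2\<close> of adjacency matrices is that
\<open>u v x u w y = 0\<close> whenever exactly one of \<open>v \<sim> w\<close> and \<open>x \<sim> y\<close> holds
(\<open>adjacency_intertwiner_iff\<close>). It comes from a sandwich principle: as rows and columns sum to
\<open>1\<close>, two elements \<open>s, t\<close> agree as soon as, for fixed \<open>v\<close> and \<open>y\<close>,
\<open>u v x s u w y = u v x t u w y\<close> holds for all \<open>x\<close> and \<open>w\<close>. The same principle, with various choices of the two
partitions of unity, proves the remaining sum identities.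

From the hypergraph relations: the incidence equation says that \<open>row v f\<close> is the partial column
sum of the edge matrix \<open>q\<close> over the edges at \<open>v\<close>. Multiplying two such partial sums leaves only
the edges containing both vertices, and a simple graph has at most one, so
\<open>q {v, w} f = row v f row w f\<close> (\<open>row_mult_row\<close>). This has two consequences. The edge matrix is
determined by \<open>u\<close>, so the algebra of the hypergraph game is generated by the vertex matrix alone;
and the right-hand side is symmetric in \<open>v\<close> and \<open>w\<close>. Compressing this symmetry by \<open>u v x\<close> gives the
commutation of \<open>u v x\<close> with \<open>u w y\<close> for edges \<open>v \<sim> w\<close>, \<open>x \<sim> y\<close>
(\<open>adjacent_entries_commute\<close>), and the vanishing products follow as well
(\<open>adjacency_preserved\<close>).

From the graph relations with commutation: the formula above is taken as the definition of the edge
matrix. For \<open>v \<sim> w\<close> all entries of row \<open>v\<close> commute with all entries of row \<open>w\<close>, because the products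
not covered by the commutators vanish. Hence the value does not depend on the order of the end
points, it is a projection, and it equals the expression with the roles of the two graphs
exchanged (\<open>edge_entry_transpose\<close>). The last point yields the column relations from the row
relations.

The universal properties turn the translations into star-homomorphisms in both directions, and
these are mutually inverse because they are so on generators. The universal property of the free
star-algebra, on which everything rests, is evaluation of words at chosen elements
(\<open>free_eval_hom\<close>, \<open>free_hom_eqI\<close>).\<close>

section \<open>Homomorphisms and quotients of star-algebras\<close>

lemma (in star_algebra) zero_smult: "x \<in> carrier A \<Longrightarrow> 0 \<odot> x = \<zero>"
  using smult_l_distr[of x 0 0] smult_closed[of x 0] by simp

lemma (in star_algebra) smult_zero: "c \<odot> \<zero> = \<zero>"
  using smult_r_distr[of \<zero> \<zero> c] smult_closed[of \<zero> c] by simp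

lemma (in star_algebra) star_zero: "star A \<zero> = \<zero>"
  using star_add[of \<zero> \<zero>] star_closed[of \<zero>] by simp

lemma (in star_algebra) star_one: "star A \<one> = \<one>"
  using star_mult[of "star A \<one>" \<one>] star_closed[of \<one>] by (simp add: star_star)

lemma (in star_algebra) finsum_smult:
  assumes "g \<in> S \<rightarrow> carrier A"
  shows "c \<odot> (\<Oplus>w\<in>S. g w) = (\<Oplus>w\<in>S. c \<odot> g w)"
  using assms
proof (induction S rule: infinite_finite_induct)
  case (insert w S)
  then show ?case by (simp add: smult_r_distr smult_closed Pi_iff)
qed (simp_all add: smult_zero)

lemma (in star_algebra) finsum_star:
  assumes "g \<in> S \<rightarrow> carrier A"
  shows "star A (\<Oplus>w\<in>S. g w) = (\<Oplus>w\<in>S. star A (g w))"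
  using assms
proof (induction S rule: infinite_finite_induct)
  case (insert w S)
  then show ?case by (simp add: star_add star_closed Pi_iff)
qed (simp_all add: star_zero)

definition star_alg_hom ::
    "('a, 'c) star_alg_scheme \<Rightarrow> ('b, 'd) star_alg_scheme \<Rightarrow> ('a \<Rightarrow> 'b) set" where
  "star_alg_hom A B = {h \<in> ring_hom A B. \<forall>x\<in>carrier A.
     (\<forall>c. h (c \<odot>\<^bsub>A\<^esub> x) = c \<odot>\<^bsub>B\<^esub> h x) \<and> h (star A x) = star B (h x)}"

lemma star_alg_hom_simps:
  assumes "h \<in> star_alg_hom A B"
  shows "x \<in> carrier A \<Longrightarrow> h x \<in> carrier B"
    and "x \<in> carrier A \<Longrightarrow> y \<in> carrier A \<Longrightarrow> h (x \<otimes>\<^bsub>A\<^esub> y) = h x \<otimes>\<^bsub>B\<^esub> h y"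
    and "x \<in> carrier A \<Longrightarrow> y \<in> carrier A \<Longrightarrow> h (x \<oplus>\<^bsub>A\<^esub> y) = h x \<oplus>\<^bsub>B\<^esub> h y"
    and "h \<one>\<^bsub>A\<^esub> = \<one>\<^bsub>B\<^esub>"
    and "x \<in> carrier A \<Longrightarrow> h (c \<odot>\<^bsub>A\<^esub> x) = c \<odot>\<^bsub>B\<^esub> h x"
    and "x \<in> carrier A \<Longrightarrow> h (star A x) = star B (h x)"
  using assms by (auto simp: star_alg_hom_def ring_hom_def)

lemma star_alg_hom_ring_hom_ring:
  assumes "star_algebra A" "star_algebra B" "h \<in> star_alg_hom A B"
  shows "ring_hom_ring A B h"
  using assms by (intro ring_hom_ringI2) (auto simp: star_algebra_def star_alg_hom_def)

lemma star_alg_hom_compose: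
  assumes "h \<in> star_alg_hom A B" "k \<in> star_alg_hom B C"
  shows "k \<circ> h \<in> star_alg_hom A C"
  using assms by (auto simp: star_alg_hom_def ring_hom_def Pi_iff)

lemma star_alg_hom_id: "id \<in> star_alg_hom A A"
  by (auto simp: star_alg_hom_def ring_hom_def)

lemma inverse_homs_star_alg_iso:
  assumes h: "h \<in> star_alg_hom A B" and k: "k \<in> star_alg_hom B A"
    and kh: "\<And>x. x \<in> carrier A \<Longrightarrow> k (h x) = x" and hk: "\<And>y. y \<in> carrier B \<Longrightarrow> h (k y) = y"
  shows "h \<in> star_alg_iso A B"
proof -
  have "bij_betw h (carrier A) (carrier B)"
    by (rule bij_betw_byWitness[where f' = k])
      (use kh hk star_alg_hom_simps(1)[OF h] star_alg_hom_simps(1)[OF k] in auto)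
  with h show ?thesis
    by (auto simp: star_alg_hom_def star_alg_iso_def ring_iso_def)
qed

lemma star_alg_hom_minus:
  assumes A: "star_algebra A" and B: "star_algebra B" and h: "h \<in> star_alg_hom A B"
    and a: "a \<in> carrier A" and b: "b \<in> carrier A"
  shows "h (a \<ominus>\<^bsub>A\<^esub> b) = h a \<ominus>\<^bsub>B\<^esub> h b"
proof -
  interpret A: star_algebra A by fact
  interpret B: star_algebra B by fact
  have "h (a \<ominus>\<^bsub>A\<^esub> b) \<oplus>\<^bsub>B\<^esub> h b = h (a \<ominus>\<^bsub>A\<^esub> b \<oplus>\<^bsub>A\<^esub> b)"
    using a b by (simp add: star_alg_hom_simps[OF h])
  also have "a \<ominus>\<^bsub>A\<^esub> b \<oplus>\<^bsub>A\<^esub> b = a"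
    using a b by (simp add: A.minus_eq A.a_assoc A.l_neg)
  finally have "h (a \<ominus>\<^bsub>A\<^esub> b) \<oplus>\<^bsub>B\<^esub> h b \<ominus>\<^bsub>B\<^esub> h b = h a \<ominus>\<^bsub>B\<^esub> h b" by simp
  moreover have "h (a \<ominus>\<^bsub>A\<^esub> b) \<oplus>\<^bsub>B\<^esub> h b \<ominus>\<^bsub>B\<^esub> h b = h (a \<ominus>\<^bsub>A\<^esub> b)"
    using a b star_alg_hom_simps(1)[OF h] by (simp add: B.minus_eq B.a_assoc B.r_neg)
  ultimately show ?thesis by simp
qed

lemma star_alg_hom_zero:
  assumes A: "star_algebra A" and B: "star_algebra B" and h: "h \<in> star_alg_hom A B"
  shows "h \<zero>\<^bsub>A\<^esub> = \<zero>\<^bsub>B\<^esub>"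
proof -
  interpret A: star_algebra A by fact
  interpret B: star_algebra B by fact
  have "h \<zero>\<^bsub>A\<^esub> = h (0 \<odot>\<^bsub>A\<^esub> \<zero>\<^bsub>A\<^esub>)"
    by (simp add: A.zero_smult)
  also have "\<dots> = 0 \<odot>\<^bsub>B\<^esub> h \<zero>\<^bsub>A\<^esub>"
    using star_alg_hom_simps(5)[OF h A.zero_closed] by blast
  also have "\<dots> = \<zero>\<^bsub>B\<^esub>"
    using star_alg_hom_simps(1)[OF h A.zero_closed] by (rule B.zero_smult)
  finally show ?thesis .
qed

lemma star_alg_hom_finsum:
  assumes A: "star_algebra A" and B: "star_algebra B" and h: "h \<in> star_alg_hom A B"
    and g: "\<And>i. i \<in> S \<Longrightarrow> g i \<in> carrier A" and k: "\<And>i. i \<in> S \<Longrightarrow> h (g i) = k i"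
  shows "h (\<Oplus>\<^bsub>A\<^esub>i\<in>S. g i) = (\<Oplus>\<^bsub>B\<^esub>i\<in>S. k i)"
proof -
  interpret A: star_algebra A by fact
  interpret B: star_algebra B by fact
  have "h (\<Oplus>\<^bsub>A\<^esub>i\<in>S. g i) = (\<Oplus>\<^bsub>B\<^esub>i\<in>S. h (g i))"
    using ring_hom_ring.hom_finsum[OF star_alg_hom_ring_hom_ring[OF A B h], of g S] g
    by (simp add: comp_def Pi_iff)
  also have "\<dots> = (\<Oplus>\<^bsub>B\<^esub>i\<in>S. k i)"
    using k star_alg_hom_simps(1)[OF h g] by (intro B.finsum_cong') (auto simp: Pi_iff)
  finally show ?thesis .
qed

lemma mem_a_kernel: "x \<in> a_kernel A B h \<longleftrightarrow> x \<in> carrier A \<and> h x = \<zero>\<^bsub>B\<^esub>"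
  by (simp add: a_kernel_def kernel_def)

text \<open>The star-ideal generated by a set is contained in the kernel of every star-homomorphism that
annihilates the set; for this the kernel has to be closed under the star.\<close>

lemma star_ideal_kernel:
  assumes A: "star_algebra A" and B: "star_algebra B" and h: "h \<in> star_alg_hom A B"
  shows "star_ideal (a_kernel A B h) A"
proof -
  interpret A: star_algebra A by fact
  interpret B: star_algebra B by fact
  interpret h: ring_hom_ring A B h by (rule star_alg_hom_ring_hom_ring[OF A B h])
  have "star A x \<in> a_kernel A B h" if "x \<in> a_kernel A B h" for x
    using that star_alg_hom_simps(6)[OF h, of x] B.star_zero
    unfolding mem_a_kernel using A.star_closed[of x] by presburger
  then show ?thesis
    using h.kernel_is_ideal by (simp add: star_ideal_def)
qed

lemma star_quot_carrierD:
  "y \<in> carrier (star_quot A I) \<Longrightarrow> \<exists>x\<in>carrier A. y = I +>\<^bsub>A\<^esub> x"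
  by (auto simp: star_quot_def A_RCOSETS_def')

text \<open>A homomorphism that annihilates the generators of the ideal is constant on cosets, so its image of
a coset is a singleton, whose element is the value of the induced map.\<close>

lemma star_quot_lift:
  assumes A: "star_algebra A" and B: "star_algebra B" and h: "h \<in> star_alg_hom A B"
    and S: "S \<subseteq> carrier A" and zero: "\<And>s. s \<in> S \<Longrightarrow> h s = \<zero>\<^bsub>B\<^esub>"
  obtains k where "k \<in> star_alg_hom (star_quot A (star_idl A S)) B"
    "\<And>x. x \<in> carrier A \<Longrightarrow> k (star_idl A S +>\<^bsub>A\<^esub> x) = h x"
proof -
  interpret A: star_algebra A by fact
  interpret B: star_algebra B by fact
  let ?I = "star_idl A S" let ?Q = "star_quot A ?I"
  have I: "star_ideal ?I A" by (rule A.star_ideal_star_idl(1)[OF S])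
  interpret I: ideal ?I A using I by (simp add: star_ideal_def)
  have "S \<subseteq> a_kernel A B h" using S zero unfolding subset_iff mem_a_kernel by blast
  then have "?I \<subseteq> a_kernel A B h"
    using star_ideal_kernel[OF A B h] by (auto simp: star_idl_def)
  then have ker: "h i = \<zero>\<^bsub>B\<^esub>" if "i \<in> ?I" for i
    using that by (simp add: subset_iff mem_a_kernel)
  define k where "k X = the_elem (h ` X)" for X
  have k: "k (?I +>\<^bsub>A\<^esub> x) = h x" if x: "x \<in> carrier A" for x
  proof -
    have "h ` (?I +>\<^bsub>A\<^esub> x) = {h x}"
      using x I.a_rcos_self[OF x] I.a_Hcarr star_alg_hom_simps(1,3)[OF h]
      by (force simp: a_r_coset_def' ker)
    then show ?thesis by (simp add: k_def)
  qed
  have "k \<in> star_alg_hom ?Q B"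
    unfolding star_alg_hom_def
  proof (safe intro!: ring_hom_memI)
    fix X assume "X \<in> carrier ?Q"
    then obtain x where x: "x \<in> carrier A" "X = ?I +>\<^bsub>A\<^esub> x" using star_quot_carrierD by blast
    show "k X \<in> carrier B" using x by (simp add: k star_alg_hom_simps[OF h])
    show "k (c \<odot>\<^bsub>?Q\<^esub> X) = c \<odot>\<^bsub>B\<^esub> k X" for c
      using x by (simp add: A.star_quot_rep[OF I] k A.smult_closed star_alg_hom_simps[OF h])
    show "k (star ?Q X) = star B (k X)"
      using x by (simp add: A.star_quot_rep[OF I] k A.star_closed star_alg_hom_simps[OF h])
    fix Y assume "Y \<in> carrier ?Q"
    then obtain y where y: "y \<in> carrier A" "Y = ?I +>\<^bsub>A\<^esub> y" using star_quot_carrierD by blast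
    show "k (X \<otimes>\<^bsub>?Q\<^esub> Y) = k X \<otimes>\<^bsub>B\<^esub> k Y"
      using x y by (simp add: star_quot_def I.rcoset_mult_add k star_alg_hom_simps[OF h])
    show "k (X \<oplus>\<^bsub>?Q\<^esub> Y) = k X \<oplus>\<^bsub>B\<^esub> k Y"
      using x y by (simp add: star_quot_def I.a_rcos_sum k star_alg_hom_simps[OF h])
  next
    show "k \<one>\<^bsub>?Q\<^esub> = \<one>\<^bsub>B\<^esub>" by (simp add: star_quot_def k star_alg_hom_simps[OF h])
  qed
  then show thesis using k by (rule that)
qed

lemma star_quot_proj:
  assumes A: "star_algebra A" and I: "star_ideal I A"
  shows "(\<lambda>x. I +>\<^bsub>A\<^esub> x) \<in> star_alg_hom A (star_quot A I)"
proof -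
  interpret A: star_algebra A by fact
  interpret I: ideal I A using I by (simp add: star_ideal_def)
  show ?thesis
    by (auto simp: star_alg_hom_def ring_hom_def A.star_quot_rep[OF I])
     (auto simp: star_quot_def I.rcoset_mult_add I.a_rcos_sum A.a_rcosetsI[OF I.a_subset])
qed

section \<open>The universal property of the free star-algebra\<close>

text \<open>The words form a basis of the free star-algebra; this is the basis vector of a word.\<close>

definition free_word :: "('x \<times> bool) list \<Rightarrow> 'x free_elem" where
  "free_word w = (\<lambda>v. if v = w then 1 else 0)"

primrec word_value :: "('b, 'c) star_alg_scheme \<Rightarrow> ('x \<Rightarrow> 'b) \<Rightarrow> ('x \<times> bool) list \<Rightarrow> 'b" where
  "word_value B f [] = \<one>\<^bsub>B\<^esub>"
| "word_value B f (l # w) =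
     (if snd l then star B (f (fst l)) else f (fst l)) \<otimes>\<^bsub>B\<^esub> word_value B f w"

definition free_eval :: "('b, 'c) star_alg_scheme \<Rightarrow> ('x \<Rightarrow> 'b) \<Rightarrow> 'x free_elem \<Rightarrow> 'b" where
  "free_eval B f a = (\<Oplus>\<^bsub>B\<^esub>w\<in>{w. a w \<noteq> 0}. a w \<odot>\<^bsub>B\<^esub> word_value B f w)"

lemma free_word_closed: "w \<in> lists (X \<times> UNIV) \<Longrightarrow> free_word w \<in> carrier (free_star_alg X)"
  by (rule carrier_freeI[where S = "{w}"]) (auto simp: free_word_def)

lemma free_word_mult: "free_word u \<otimes>\<^bsub>free_star_alg X\<^esub> free_word v = free_word (u @ v)"
proof
  fix w
  have "(\<Sum>i\<le>length w. free_word u (take i w) * free_word v (drop i w)) =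
      (\<Sum>i\<le>length w. if i = length u then free_word (u @ v) w else 0)"
  proof (rule sum.cong)
    fix i assume "i \<in> {..length w}"
    then have i: "length (take i w) = i" by simp
    show "free_word u (take i w) * free_word v (drop i w) =
        (if i = length u then free_word (u @ v) w else 0 :: complex)"
      using append_eq_append_conv[of "take i w" u "drop i w" v] i by (auto simp: free_word_def)
  qed simp
  also have "\<dots> = free_word (u @ v) w"
    by (auto simp: free_word_def)
  finally show "(free_word u \<otimes>\<^bsub>free_star_alg X\<^esub> free_word v) w = free_word (u @ v) w"
    by (simp add: free_star_alg_def)
qed

lemma free_word_star: "star (free_star_alg X) (free_word w) = free_word (word_star w)"
proof
  fix v
  have "word_star v = w \<longleftrightarrow> v = word_star w"
    using word_star_simps(2) by metis
  then show "star (free_star_alg X) (free_word w) v = free_word (word_star w) v"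
    by (simp add: free_star_alg_def free_word_def)
qed

lemma free_word_gen:
  "free_word [] = \<one>\<^bsub>free_star_alg X\<^esub>" "free_word [(x, False)] = free_gen x"
  "free_word [(x, True)] = star (free_star_alg X) (free_gen x)"
proof -
  show gen: "free_word [(x, False)] = free_gen x"
    by (simp add: free_word_def free_gen_def)
  show "free_word [(x, True)] = star (free_star_alg X) (free_gen x)"
    unfolding gen[symmetric] free_word_star by (simp add: word_star_def)
qed (simp add: free_word_def free_star_alg_def)

text \<open>Finite support makes every element a finite sum of scaled words, so a linear statement needs to be
checked on words only.\<close>

lemma free_induct [consumes 1, case_names zero word add]:
  assumes a: "a \<in> carrier (free_star_alg X)"
    and zero: "P \<zero>\<^bsub>free_star_alg X\<^esub>"
    and word: "\<And>c w. w \<in> lists (X \<times> UNIV) \<Longrightarrow> P (c \<odot>\<^bsub>free_star_alg X\<^esub> free_word w)"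
    and add: "\<And>a b. a \<in> carrier (free_star_alg X) \<Longrightarrow> b \<in> carrier (free_star_alg X) \<Longrightarrow>
      P a \<Longrightarrow> P b \<Longrightarrow> P (a \<oplus>\<^bsub>free_star_alg X\<^esub> b)"
  shows "P a"
proof -
  interpret F: star_algebra "free_star_alg X" by (rule star_algebra_free)
  \<comment> \<open>The support is enlarged to a finite set of words, on which one can induct.\<close>
  have supported: "P a" if "finite S" "S \<subseteq> lists (X \<times> UNIV)" "\<And>w. w \<notin> S \<Longrightarrow> a w = 0" for S a
    using that
  proof (induction S arbitrary: a rule: finite_induct)
    case empty
    then have "a = \<zero>\<^bsub>free_star_alg X\<^esub>" by (auto simp: free_star_alg_def)
    then show ?case using zero by simp
  next
    case (insert w S)
    have "P (a(w := 0))" using insert.prems by (intro insert.IH) auto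
    moreover have "a(w := 0) \<in> carrier (free_star_alg X)"
      using insert.prems insert.hyps(1) by (intro carrier_freeI[where S = S]) auto
    moreover have "a = (a w \<odot>\<^bsub>free_star_alg X\<^esub> free_word w) \<oplus>\<^bsub>free_star_alg X\<^esub> a(w := 0)"
      by (auto simp: free_star_alg_def free_word_def)
    ultimately show ?case
      using add[of "a w \<odot>\<^bsub>free_star_alg X\<^esub> free_word w" "a(w := 0)"] word[of w "a w"]
        insert.prems(1) by (simp add: F.smult_closed free_word_closed)
  qed
  show ?thesis
  proof (rule supported)
    show "finite {w. a w \<noteq> 0}" "{w. a w \<noteq> 0} \<subseteq> lists (X \<times> UNIV)"
      using a by (simp_all add: free_star_alg_def)
  qed simp
qed

text \<open>A homomorphism is determined on words by its values on the generators.\<close>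

lemma free_hom_word:
  assumes h: "h \<in> star_alg_hom (free_star_alg X) B" and w: "w \<in> lists (X \<times> UNIV)"
  shows "h (free_word w) = word_value B (\<lambda>x. h (free_gen x)) w"
  using w
proof (induction w)
  case Nil
  then show ?case using star_alg_hom_simps(4)[OF h] by (simp add: free_word_gen(1)[where X = X])
next
  case (Cons l w)
  interpret F: star_algebra "free_star_alg X" by (rule star_algebra_free)
  obtain x b where l: "l = (x, b)" by fastforce
  have "free_word (l # w) = free_word [l] \<otimes>\<^bsub>free_star_alg X\<^esub> free_word w"
    by (simp add: free_word_mult)
  then have "h (free_word (l # w)) = h (free_word [l]) \<otimes>\<^bsub>B\<^esub> h (free_word w)"
    using Cons.hyps by (simp add: star_alg_hom_simps(2)[OF h] free_word_closed)
  moreover have "h (free_word [l]) = (if b then star B (h (free_gen x)) else h (free_gen x))"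
    using Cons.hyps l
    by (cases b) (simp_all add: free_word_gen(2) free_word_gen(3)[where X = X] star_alg_hom_simps(6)[OF h] free_gen_closed)
  ultimately show ?case using Cons.IH l by simp
qed

lemma (in star_algebra) word_value_closed:
  assumes "\<And>x. x \<in> X \<Longrightarrow> f x \<in> carrier A" "w \<in> lists (X \<times> UNIV)"
  shows "word_value A f w \<in> carrier A"
  using assms(2) by induction (auto simp: star_closed assms(1))

lemma (in star_algebra) word_value_append:
  assumes f: "\<And>x. x \<in> X \<Longrightarrow> f x \<in> carrier A" and "u \<in> lists (X \<times> UNIV)" "v \<in> lists (X \<times> UNIV)"
  shows "word_value A f (u @ v) = word_value A f u \<otimes> word_value A f v"
  using assms(2)
proof induction
  case Nil
  then show ?case using word_value_closed[OF f assms(3)] by simp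
next
  case (Cons l u)
  then show ?case
    using word_value_closed[OF f assms(3)] word_value_closed[OF f Cons.hyps(2)]
    by (auto simp: m_assoc star_closed f)
qed

lemma (in star_algebra) word_value_star:
  assumes f: "\<And>x. x \<in> X \<Longrightarrow> f x \<in> carrier A" and "w \<in> lists (X \<times> UNIV)"
  shows "word_value A f (word_star w) = star A (word_value A f w)"
  using assms(2)
proof induction
  case Nil
  then show ?case by (simp add: star_one)
next
  case (Cons l w)
  obtain x b where l: "l = (x, b)" by fastforce
  have x: "f x \<in> carrier A" using Cons.hyps l f by auto
  have "word_star (l # w) = word_star w @ [(x, \<not> b)]"
    by (simp add: word_star_def l)
  then have "word_value A f (word_star (l # w)) =
      word_value A f (word_star w) \<otimes> word_value A f [(x, \<not> b)]"
    using Cons.hyps l word_value_append[OF f, where u = "word_star w" and v = "[(x, \<not> b)]"] by simp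
  also have "\<dots> = star A (word_value A f w) \<otimes> word_value A f [(x, \<not> b)]"
    by (simp add: Cons.IH)
  also have "\<dots> = star A (word_value A f (l # w))"
    using x word_value_closed[OF f Cons.hyps(2)] l by (auto simp: star_mult star_star star_closed)
  finally show ?case .
qed

text \<open>Existence half of the universal property. Additivity and homogeneity hold because the defining sum
may be taken over any finite set of words containing the support; multiplicativity and
compatibility with the star are linear (or antilinear) in each argument and thus reduce to words,
where they are concatenation and reversal.\<close>

lemma free_eval_hom:
  assumes B: "star_algebra B" and f: "\<And>x. x \<in> X \<Longrightarrow> f x \<in> carrier B"
  shows "free_eval B f \<in> star_alg_hom (free_star_alg X) B"
    and "\<And>x. x \<in> X \<Longrightarrow> free_eval B f (free_gen x) = f x"
proof -
  let ?F = "free_star_alg X"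
  interpret F: star_algebra ?F by (rule star_algebra_free)
  interpret B: star_algebra B by fact
  have val: "w \<in> lists (X \<times> UNIV) \<Longrightarrow> word_value B f w \<in> carrier B" for w
    by (rule B.word_value_closed[OF f])
  have support: "free_eval B f a = (\<Oplus>\<^bsub>B\<^esub>w\<in>S. a w \<odot>\<^bsub>B\<^esub> word_value B f w)"
    if "finite S" "S \<subseteq> lists (X \<times> UNIV)" "{w. a w \<noteq> 0} \<subseteq> S" for a S
    unfolding free_eval_def using that
    by (intro B.add.finprod_mono_neutral_cong_left) (auto simp: B.zero_smult val B.smult_closed subset_iff)
  have eval_word: "free_eval B f (free_word w) = word_value B f w" if "w \<in> lists (X \<times> UNIV)" for w
    using that support[of "{w}" "free_word w"]
    by (simp add: free_word_def val B.smult_closed B.smult_one)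
  have carr: "finite {w. a w \<noteq> 0}" "{w. a w \<noteq> 0} \<subseteq> lists (X \<times> UNIV)" if "a \<in> carrier ?F" for a
    using that by (simp_all add: free_star_alg_def)
  have closed: "free_eval B f a \<in> carrier B" if "a \<in> carrier ?F" for a
    unfolding free_eval_def using subsetD[OF carr(2)[OF that]]
    by (intro B.finsum_closed) (auto intro!: B.smult_closed val)
  have smult: "free_eval B f (c \<odot>\<^bsub>?F\<^esub> a) = c \<odot>\<^bsub>B\<^esub> free_eval B f a" if a: "a \<in> carrier ?F" for c a
  proof -
    have "free_eval B f (c \<odot>\<^bsub>?F\<^esub> a) = (\<Oplus>\<^bsub>B\<^esub>w\<in>{w. a w \<noteq> 0}. c \<odot>\<^bsub>B\<^esub> (a w \<odot>\<^bsub>B\<^esub> word_value B f w))"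
      using subsetD[OF carr(2)[OF a]] by (subst support[OF carr[OF a]])
        (auto simp: free_star_alg_def B.smult_smult[OF val] intro!: B.finsum_cong' B.smult_closed val)
    also have "\<dots> = c \<odot>\<^bsub>B\<^esub> free_eval B f a"
      unfolding free_eval_def using subsetD[OF carr(2)[OF a]]
      by (intro B.finsum_smult[symmetric]) (auto intro!: B.smult_closed val)
    finally show ?thesis .
  qed
  have eval_add: "free_eval B f (a \<oplus>\<^bsub>?F\<^esub> b) = free_eval B f a \<oplus>\<^bsub>B\<^esub> free_eval B f b"
    if a: "a \<in> carrier ?F" and b: "b \<in> carrier ?F" for a b
  proof -
    let ?S = "{w. a w \<noteq> 0} \<union> {w. b w \<noteq> 0}"
    have S: "finite ?S" "?S \<subseteq> lists (X \<times> UNIV)" using carr[OF a] carr[OF b] by auto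
    have val': "c \<odot>\<^bsub>B\<^esub> word_value B f w \<in> carrier B" if "w \<in> ?S" for c w
      using subsetD[OF S(2) that] by (rule B.smult_closed[OF val])
    have "free_eval B f (a \<oplus>\<^bsub>?F\<^esub> b) = (\<Oplus>\<^bsub>B\<^esub>w\<in>?S. (a \<oplus>\<^bsub>?F\<^esub> b) w \<odot>\<^bsub>B\<^esub> word_value B f w)"
      by (rule support[OF S]) (auto simp: free_star_alg_def)
    also have "\<dots> = (\<Oplus>\<^bsub>B\<^esub>w\<in>?S. a w \<odot>\<^bsub>B\<^esub> word_value B f w \<oplus>\<^bsub>B\<^esub> b w \<odot>\<^bsub>B\<^esub> word_value B f w)"
      using val[OF subsetD[OF S(2)]] val'
      by (intro B.finsum_cong') (simp_all add: free_star_alg_def B.smult_l_distr Pi_iff)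
    also have "\<dots> = free_eval B f a \<oplus>\<^bsub>B\<^esub> free_eval B f b"
      using val' by (subst (1 2) support[OF S]) (auto intro!: B.finsum_addf)
    finally show ?thesis .
  qed
  have eval_zero: "free_eval B f \<zero>\<^bsub>?F\<^esub> = \<zero>\<^bsub>B\<^esub>"
    by (simp add: free_eval_def free_star_alg_def)
  have scaled_word: "c \<odot>\<^bsub>?F\<^esub> free_word w \<in> carrier ?F"
    "free_eval B f (c \<odot>\<^bsub>?F\<^esub> free_word w) = c \<odot>\<^bsub>B\<^esub> word_value B f w"
    if "w \<in> lists (X \<times> UNIV)" for c w
    using that by (simp_all add: F.smult_closed free_word_closed smult eval_word)
  have word_mult: "free_eval B f (free_word u \<otimes>\<^bsub>?F\<^esub> b) = word_value B f u \<otimes>\<^bsub>B\<^esub> free_eval B f b"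
    if b: "b \<in> carrier ?F" and u: "u \<in> lists (X \<times> UNIV)" for u b
    using b
  proof (induction b rule: free_induct)
    case zero
    then show ?case using u by (simp add: free_word_closed val eval_zero)
  next
    case (word c v)
    have "free_word u \<otimes>\<^bsub>?F\<^esub> (c \<odot>\<^bsub>?F\<^esub> free_word v) = c \<odot>\<^bsub>?F\<^esub> free_word (u @ v)"
      using u word by (simp add: F.smult_mult_right free_word_closed free_word_mult)
    then show ?case
      using u word B.word_value_append[OF f u word]
      by (simp add: scaled_word val B.smult_mult_right)
  next
    case (add a b)
    then show ?case
      using u by (simp add: F.r_distr B.r_distr free_word_closed val closed eval_add)
  qed
  have mult: "free_eval B f (a \<otimes>\<^bsub>?F\<^esub> b) = free_eval B f a \<otimes>\<^bsub>B\<^esub> free_eval B f b"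
    if a: "a \<in> carrier ?F" and b: "b \<in> carrier ?F" for a b
    using a
  proof (induction a rule: free_induct)
    case zero
    then show ?case using b closed[OF b] by (simp add: eval_zero)
  next
    case (word c u)
    then show ?case
      using b by (simp add: F.smult_mult_left B.smult_mult_left free_word_closed smult
          scaled_word val closed word_mult eval_word)
  next
    case (add a c)
    then show ?case
      using b by (simp add: F.l_distr B.l_distr closed eval_add)
  qed
  have star: "free_eval B f (star ?F a) = star B (free_eval B f a)" if a: "a \<in> carrier ?F" for a
    using a
  proof (induction a rule: free_induct)
    case zero
    then show ?case by (simp add: F.star_zero B.star_zero eval_zero)
  next
    case (word c w)
    then show ?case
      using scaled_word(2)[of "word_star w" "cnj c"] B.word_value_star[OF f word]
      by (simp add: F.star_smult free_word_closed free_word_star scaled_word B.star_smult val)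
  next
    case (add a b)
    then show ?case
      by (simp add: F.star_add B.star_add F.star_closed closed eval_add)
  qed
  have one: "free_eval B f \<one>\<^bsub>?F\<^esub> = \<one>\<^bsub>B\<^esub>"
    using eval_word[of "[]"] by (simp add: free_word_gen(1)[where X = X])
  show "free_eval B f \<in> star_alg_hom ?F B"
    using closed smult eval_add mult star one by (auto simp: star_alg_hom_def intro!: ring_hom_memI)
  show "free_eval B f (free_gen x) = f x" if "x \<in> X" for x
    using eval_word[of "[(x, False)]"] that f by (simp add: free_word_gen(2))
qed

text \<open>Uniqueness half of the universal property.\<close>

lemma free_hom_eqI:
  assumes h: "h \<in> star_alg_hom (free_star_alg X) B" and k: "k \<in> star_alg_hom (free_star_alg X) B"
    and gen: "\<And>x. x \<in> X \<Longrightarrow> h (free_gen x) = k (free_gen x)"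
    and B: "star_algebra B"
    and a: "a \<in> carrier (free_star_alg X)"
  shows "h a = k a"
proof -
  let ?F = "free_star_alg X"
  interpret F: star_algebra ?F by (rule star_algebra_free)
  interpret B: star_algebra B by fact
  have word: "h (c \<odot>\<^bsub>?F\<^esub> free_word w) = k (c \<odot>\<^bsub>?F\<^esub> free_word w)" if "w \<in> lists (X \<times> UNIV)" for c w
  proof -
    have "word_value B (\<lambda>x. h (free_gen x)) w = word_value B (\<lambda>x. k (free_gen x)) w"
      using that by induction (auto simp: gen)
    with that show ?thesis
      by (simp add: star_alg_hom_simps(5)[OF h] star_alg_hom_simps(5)[OF k] free_word_closed
        free_hom_word[OF h] free_hom_word[OF k])
  qed
  show ?thesis
    using a
  proof (induction a rule: free_induct)
    case zero
    show ?case
      using word[of "[]" 0] by (simp add: F.zero_smult free_word_gen(1)[where X = X])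
  qed (simp_all add: word star_alg_hom_simps(3)[OF h] star_alg_hom_simps(3)[OF k])
qed

section \<open>Star-algebras with generators and relations\<close>

lemma relators_closed:
  assumes "R \<subseteq> carrier (free_star_alg X) \<times> carrier (free_star_alg X)"
  shows "{a \<ominus>\<^bsub>free_star_alg X\<^esub> b | a b. (a, b) \<in> R} \<subseteq> carrier (free_star_alg X)"
proof -
  interpret F: star_algebra "free_star_alg X" by (rule star_algebra_free)
  show ?thesis using assms by (auto intro!: F.minus_closed)
qed

text \<open>The relators \<open>a \<ominus> b\<close> generate the ideal, and the evaluation at \<open>f\<close> annihilates them exactly
when the relations hold under it.\<close>

lemma presented_star_alg_lift:
  assumes R: "R \<subseteq> carrier (free_star_alg X) \<times> carrier (free_star_alg X)"
    and B: "star_algebra B" and f: "\<And>x. x \<in> X \<Longrightarrow> f x \<in> carrier B"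
    and rel: "\<And>a b. (a, b) \<in> R \<Longrightarrow> free_eval B f a = free_eval B f b"
  obtains k where "k \<in> star_alg_hom (presented_star_alg X R) B"
    "\<And>x. x \<in> X \<Longrightarrow> k (presented_gen X R x) = f x"
proof -
  let ?F = "free_star_alg X"
  note F = star_algebra_free[of X]
  interpret F: star_algebra ?F by (rule F)
  interpret B: star_algebra B by (rule B)
  have h: "free_eval B f \<in> star_alg_hom ?F B" by (rule free_eval_hom(1)[OF B f])
  let ?S = "{a \<ominus>\<^bsub>?F\<^esub> b | a b. (a, b) \<in> R}"
  have S: "?S \<subseteq> carrier ?F" using R by (rule relators_closed)
  have "free_eval B f s = \<zero>\<^bsub>B\<^esub>" if s: "s \<in> ?S" for s
  proof -
    obtain a b where ab: "s = a \<ominus>\<^bsub>?F\<^esub> b" "(a, b) \<in> R" "a \<in> carrier ?F" "b \<in> carrier ?F"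
      using s R by blast
    then show ?thesis
      using star_alg_hom_minus[OF F B h] rel star_alg_hom_simps(1)[OF h] by (simp add: B.minus_eq B.r_neg)
  qed
  from star_quot_lift[OF F B h S this] obtain k
    where k: "k \<in> star_alg_hom (star_quot ?F (star_idl ?F ?S)) B"
      "\<And>x. x \<in> carrier ?F \<Longrightarrow> k (star_idl ?F ?S +>\<^bsub>?F\<^esub> x) = free_eval B f x" by blast
  show thesis
  proof (rule that)
    show "k \<in> star_alg_hom (presented_star_alg X R) B"
      using k(1) by (simp add: presented_star_alg_def rel_ideal_def)
    show "k (presented_gen X R x) = f x" if "x \<in> X" for x
      using k(2)[OF free_gen_closed[OF that]] free_eval_hom(2)[OF B f that]
      by (simp add: presented_gen_def rel_ideal_def)
  qed
qed

lemma presented_star_alg_proj: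
  assumes R: "R \<subseteq> carrier (free_star_alg X) \<times> carrier (free_star_alg X)"
  defines "\<pi> \<equiv> \<lambda>a. rel_ideal X R +>\<^bsub>free_star_alg X\<^esub> a"
  shows "\<pi> \<in> star_alg_hom (free_star_alg X) (presented_star_alg X R)"
    and "\<And>a b. (a, b) \<in> R \<Longrightarrow> \<pi> a = \<pi> b"
    and "\<And>y. y \<in> carrier (presented_star_alg X R) \<Longrightarrow> \<exists>a\<in>carrier (free_star_alg X). y = \<pi> a"
proof -
  let ?F = "free_star_alg X"
  interpret F: star_algebra ?F by (rule star_algebra_free)
  note S = relators_closed[OF R]
  have I: "star_ideal (rel_ideal X R) ?F"
    unfolding rel_ideal_def by (rule F.star_ideal_star_idl(1)[OF S])
  interpret I: ideal "rel_ideal X R" ?F using I by (simp add: star_ideal_def)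
  show "\<pi> \<in> star_alg_hom ?F (presented_star_alg X R)"
    unfolding \<pi>_def presented_star_alg_def by (rule star_quot_proj[OF star_algebra_free I])
  show "\<exists>a\<in>carrier ?F. y = \<pi> a" if "y \<in> carrier (presented_star_alg X R)" for y
    using that star_quot_carrierD unfolding presented_star_alg_def \<pi>_def by blast
  show "\<pi> a = \<pi> b" if ab: "(a, b) \<in> R" for a b
  proof -
    have carr: "a \<in> carrier ?F" "b \<in> carrier ?F" using ab R by auto
    have "a \<ominus>\<^bsub>?F\<^esub> b \<in> rel_ideal X R"
      using F.star_ideal_star_idl(2)[OF S] ab by (auto simp: rel_ideal_def)
    then show ?thesis
      unfolding \<pi>_def using F.quotient_eq_iff_same_a_r_cos[OF I.ideal_axioms carr] by simp
  qed
qed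

lemma presented_hom_eqI:
  assumes R: "R \<subseteq> carrier (free_star_alg X) \<times> carrier (free_star_alg X)"
    and B: "star_algebra B"
    and h: "h \<in> star_alg_hom (presented_star_alg X R) B"
    and k: "k \<in> star_alg_hom (presented_star_alg X R) B"
    and gen: "\<And>x. x \<in> X \<Longrightarrow> h (presented_gen X R x) = k (presented_gen X R x)"
    and y: "y \<in> carrier (presented_star_alg X R)"
  shows "h y = k y"
proof -
  obtain a where a: "a \<in> carrier (free_star_alg X)" "y = rel_ideal X R +>\<^bsub>free_star_alg X\<^esub> a"
    using presented_star_alg_proj(3)[OF R y] by blast
  note comp = star_alg_hom_compose[OF presented_star_alg_proj(1)[OF R]]
  show ?thesis
    using free_hom_eqI[OF comp[OF h] comp[OF k] _ B a(1)] gen a(2) by (simp add: presented_gen_def)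
qed

text \<open>A set of relations holds when it is contained in the identity relation. Validity under a
homomorphism can then be read off from the image of the set of relations.\<close>

lemma map_prod_subset_Id_iff: "map_prod h h ` R \<subseteq> Id \<longleftrightarrow> (\<forall>(a, b)\<in>R. h a = h b)"
  by auto

lemma map_prod_image_Collect:
  "(\<And>i. C i \<Longrightarrow> h (F i) = F' i \<and> h (G i) = G' i) \<Longrightarrow>
    map_prod h h ` {(F i, G i) | i. C i} = {(F' i, G' i) | i. C i}"
  "(\<And>i j. C2 i j \<Longrightarrow> h (F2 i j) = F2' i j \<and> h (G2 i j) = G2' i j) \<Longrightarrow>
    map_prod h h ` {(F2 i j, G2 i j) | i j. C2 i j} = {(F2' i j, G2' i j) | i j. C2 i j}"
  "(\<And>i j k. C3 i j k \<Longrightarrow> h (F3 i j k) = F3' i j k \<and> h (G3 i j k) = G3' i j k) \<Longrightarrow>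
    map_prod h h ` {(F3 i j k, G3 i j k) | i j k. C3 i j k} =
      {(F3' i j k, G3' i j k) | i j k. C3 i j k}"
  by (force simp: image_iff)+

text \<open>The relations are built by the algebra operations from the matrix entries, so a homomorphism sends
the relations for a matrix to the same relations for the image matrix. This transports
relations from the free algebra to its quotients and to the targets of evaluations.\<close>

lemma magic_unitary_rels_hom:
  assumes A: "star_algebra A" and B: "star_algebra B" and h: "h \<in> star_alg_hom A B"
    and p: "\<And>i j. i \<in> I \<Longrightarrow> j \<in> J \<Longrightarrow> p i j \<in> carrier A"
    and q: "\<And>i j. i \<in> I \<Longrightarrow> j \<in> J \<Longrightarrow> h (p i j) = q i j"
  shows "map_prod h h ` magic_unitary_rels A I J p = magic_unitary_rels B I J q"
proof -
  interpret A: star_algebra A by fact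
  interpret B: star_algebra B by fact
  note simps = star_alg_hom_simps[OF h] p q
  have sums: "i \<in> I \<Longrightarrow> h (\<Oplus>\<^bsub>A\<^esub>j\<in>J. p i j) = (\<Oplus>\<^bsub>B\<^esub>j\<in>J. q i j)"
    "j \<in> J \<Longrightarrow> h (\<Oplus>\<^bsub>A\<^esub>i\<in>I. p i j) = (\<Oplus>\<^bsub>B\<^esub>i\<in>I. q i j)" for i j
    by (rule star_alg_hom_finsum[OF A B h]; simp add: p q)+
  show ?thesis
    unfolding magic_unitary_rels_def image_Un
    by (intro arg_cong2[where f = "(\<union>)"] map_prod_image_Collect)
      (auto simp: simps sums star_alg_hom_zero[OF A B h])
qed

lemma intertwiner_rels_hom:
  assumes A: "star_algebra A" and B: "star_algebra B" and h: "h \<in> star_alg_hom A B"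
    and P: "\<And>k j. k \<in> K \<Longrightarrow> j \<in> J \<Longrightarrow> P k j \<in> carrier A"
    and P': "\<And>k j. k \<in> K \<Longrightarrow> j \<in> J \<Longrightarrow> h (P k j) = P' k j"
    and Q: "\<And>i l. i \<in> I \<Longrightarrow> l \<in> L \<Longrightarrow> Q i l \<in> carrier A"
    and Q': "\<And>i l. i \<in> I \<Longrightarrow> l \<in> L \<Longrightarrow> h (Q i l) = Q' i l"
  shows "map_prod h h ` intertwiner_rels A I K L J M P Q N = intertwiner_rels B I K L J M P' Q' N"
proof -
  interpret A: star_algebra A by fact
  have "j \<in> J \<Longrightarrow> h (\<Oplus>\<^bsub>A\<^esub>k\<in>K. M i k \<odot>\<^bsub>A\<^esub> P k j) = (\<Oplus>\<^bsub>B\<^esub>k\<in>K. M i k \<odot>\<^bsub>B\<^esub> P' k j)"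
    "i \<in> I \<Longrightarrow> h (\<Oplus>\<^bsub>A\<^esub>l\<in>L. N l j \<odot>\<^bsub>A\<^esub> Q i l) = (\<Oplus>\<^bsub>B\<^esub>l\<in>L. N l j \<odot>\<^bsub>B\<^esub> Q' i l)" for i j
    by (rule star_alg_hom_finsum[OF A B h];
        simp add: P P' Q Q' A.smult_closed star_alg_hom_simps(5)[OF h])+
  then show ?thesis
    unfolding intertwiner_rels_def by (intro map_prod_image_Collect) auto
qed

section \<open>Magic unitaries\<close>

lemma (in ring) sandwich_sum:
  assumes "a \<in> carrier R" "b \<in> carrier R" "\<And>k. k \<in> K \<Longrightarrow> s k \<in> carrier R" "finite K"
  shows "a \<otimes> (\<Oplus>k\<in>K. s k) \<otimes> b = (\<Oplus>k\<in>K. a \<otimes> s k \<otimes> b)"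
  using assms by (subst finsum_rdistr, simp_all add: Pi_iff, subst finsum_ldistr, simp_all add: Pi_iff)

text \<open>Multiplication by all members of a finite partition of unity is jointly injective, since
\<open>s = \<Sum>i. a i s\<close>.\<close>

lemma (in ring) left_cancel_partition:
  assumes S: "finite S" "\<And>i. i \<in> S \<Longrightarrow> a i \<in> carrier R" "(\<Oplus>i\<in>S. a i) = \<one>"
    and s: "s \<in> carrier R" and t: "t \<in> carrier R"
    and eq: "\<And>i. i \<in> S \<Longrightarrow> a i \<otimes> s = a i \<otimes> t"
  shows "s = t"
proof -
  have expand: "z = (\<Oplus>i\<in>S. a i \<otimes> z)" if "z \<in> carrier R" for z
    using S that finsum_ldistr[of S z a] by (simp add: Pi_iff)
  have "(\<Oplus>i\<in>S. a i \<otimes> s) = (\<Oplus>i\<in>S. a i \<otimes> t)"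
    using S t by (intro finsum_cong') (simp_all add: Pi_iff eq)
  then show ?thesis using expand[OF s] expand[OF t] by simp
qed

lemma (in ring) right_cancel_partition:
  assumes T: "finite T" "\<And>j. j \<in> T \<Longrightarrow> b j \<in> carrier R" "(\<Oplus>j\<in>T. b j) = \<one>"
    and s: "s \<in> carrier R" and t: "t \<in> carrier R"
    and eq: "\<And>j. j \<in> T \<Longrightarrow> s \<otimes> b j = t \<otimes> b j"
  shows "s = t"
proof -
  have expand: "z = (\<Oplus>j\<in>T. z \<otimes> b j)" if "z \<in> carrier R" for z
    using T that finsum_rdistr[of T z b] by (simp add: Pi_iff)
  have "(\<Oplus>j\<in>T. s \<otimes> b j) = (\<Oplus>j\<in>T. t \<otimes> b j)"
    using T t by (intro finsum_cong') (simp_all add: Pi_iff eq)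
  then show ?thesis using expand[OF s] expand[OF t] by simp
qed

text \<open>The principle behind all sum identities below: a sum becomes trivial between two matrix entries
because orthogonality kills all but at most one of its terms.\<close>

lemma (in ring) sandwich_cancel:
  assumes S: "finite S" "\<And>i. i \<in> S \<Longrightarrow> a i \<in> carrier R" "(\<Oplus>i\<in>S. a i) = \<one>"
    and T: "finite T" "\<And>j. j \<in> T \<Longrightarrow> b j \<in> carrier R" "(\<Oplus>j\<in>T. b j) = \<one>"
    and s: "s \<in> carrier R" and t: "t \<in> carrier R"
    and eq: "\<And>i j. i \<in> S \<Longrightarrow> j \<in> T \<Longrightarrow> a i \<otimes> s \<otimes> b j = a i \<otimes> t \<otimes> b j"
  shows "s = t"
proof (rule left_cancel_partition[OF S s t])
  fix i assume i: "i \<in> S"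
  show "a i \<otimes> s = a i \<otimes> t"
    by (rule right_cancel_partition[OF T]) (use i S(2) s t eq in auto)
qed

lemma (in star_algebra) finsum_if:
  assumes "finite K" "\<And>k. k \<in> K \<Longrightarrow> Q k \<Longrightarrow> g k \<in> carrier A"
  shows "(\<Oplus>k\<in>K. if Q k then g k else \<zero>) = (\<Oplus>k\<in>{k \<in> K. Q k}. g k)"
  using assms by (intro add.finprod_mono_neutral_cong_right) auto

lemma (in star_algebra) finsum_indicator_smult:
  assumes "finite K" "\<And>k. k \<in> K \<Longrightarrow> g k \<in> carrier A"
  shows "(\<Oplus>k\<in>K. (if Q k then 1 else 0) \<odot> g k) = (\<Oplus>k\<in>{k \<in> K. Q k}. g k)"
  using assms by (intro add.finprod_mono_neutral_cong_right) (auto simp: smult_one zero_smult smult_closed)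

lemma (in ring) finsum_commute:
  assumes "a \<in> carrier R" "\<And>k. k \<in> K \<Longrightarrow> g k \<in> carrier R" "finite K"
    and "\<And>k. k \<in> K \<Longrightarrow> a \<otimes> g k = g k \<otimes> a"
  shows "a \<otimes> (\<Oplus>k\<in>K. g k) = (\<Oplus>k\<in>K. g k) \<otimes> a"
  using assms by (subst finsum_rdistr, simp_all add: Pi_iff, subst finsum_ldistr, simp_all add: Pi_iff)
    (intro finsum_cong', simp_all)

text \<open>Finiteness of the index sets is required because a sum over an infinite set has the value zero,
which would make the row and column relations degenerate.\<close>

locale magic_unitary = star_algebra A for A (structure) +
  fixes I :: "'i set" and J :: "'j set" and p :: "'i \<Rightarrow> 'j \<Rightarrow> 'a"
  assumes finite_rows: "finite I" and finite_cols: "finite J"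
    and entry_closed: "i \<in> I \<Longrightarrow> j \<in> J \<Longrightarrow> p i j \<in> carrier A"
    and relations: "magic_unitary_rels A I J p \<subseteq> Id"
begin

lemma
  shows entry_star: "i \<in> I \<Longrightarrow> j \<in> J \<Longrightarrow> star A (p i j) = p i j"
    and entry_idem: "i \<in> I \<Longrightarrow> j \<in> J \<Longrightarrow> p i j \<otimes> p i j = p i j"
    and row_sum_one: "i \<in> I \<Longrightarrow> (\<Oplus>j\<in>J. p i j) = \<one>"
    and col_sum_one: "j \<in> J \<Longrightarrow> (\<Oplus>i\<in>I. p i j) = \<one>"
    and row_orthogonal: "i \<in> I \<Longrightarrow> j \<in> J \<Longrightarrow> j' \<in> J \<Longrightarrow> j \<noteq> j' \<Longrightarrow> p i j \<otimes> p i j' = \<zero>"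
    and col_orthogonal: "i \<in> I \<Longrightarrow> i' \<in> I \<Longrightarrow> j \<in> J \<Longrightarrow> i \<noteq> i' \<Longrightarrow> p i j \<otimes> p i' j = \<zero>"
proof -
  have rel: "(a, b) \<in> magic_unitary_rels A I J p \<Longrightarrow> a = b" for a b
    using relations by blast
  show "i \<in> I \<Longrightarrow> j \<in> J \<Longrightarrow> star A (p i j) = p i j"
    by (rule rel[symmetric], unfold magic_unitary_rels_def) blast
  show "i \<in> I \<Longrightarrow> j \<in> J \<Longrightarrow> p i j \<otimes> p i j = p i j"
    by (rule rel[symmetric], unfold magic_unitary_rels_def) blast
  show "i \<in> I \<Longrightarrow> (\<Oplus>j\<in>J. p i j) = \<one>"
    by (rule rel, unfold magic_unitary_rels_def) blast
  show "j \<in> J \<Longrightarrow> (\<Oplus>i\<in>I. p i j) = \<one>"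
    by (rule rel, unfold magic_unitary_rels_def) blast
  show "i \<in> I \<Longrightarrow> j \<in> J \<Longrightarrow> j' \<in> J \<Longrightarrow> j \<noteq> j' \<Longrightarrow> p i j \<otimes> p i j' = \<zero>"
    by (rule rel, unfold magic_unitary_rels_def) blast
  show "i \<in> I \<Longrightarrow> i' \<in> I \<Longrightarrow> j \<in> J \<Longrightarrow> i \<noteq> i' \<Longrightarrow> p i j \<otimes> p i' j = \<zero>"
    by (rule rel, unfold magic_unitary_rels_def) blast
qed

definition row :: "'i \<Rightarrow> 'j set \<Rightarrow> 'a" where
  "row i S = (\<Oplus>j\<in>S. p i j)"

definition col :: "'j \<Rightarrow> 'i set \<Rightarrow> 'a" where
  "col j S = (\<Oplus>i\<in>S. p i j)"

lemma row_closed: "i \<in> I \<Longrightarrow> S \<subseteq> J \<Longrightarrow> row i S \<in> carrier A"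
  unfolding row_def by (rule finsum_closed) (auto simp: entry_closed)

lemma row_single: "i \<in> I \<Longrightarrow> j \<in> J \<Longrightarrow> row i {j} = p i j"
  by (simp add: row_def entry_closed)

lemma row_empty: "row i {} = \<zero>"
  by (simp add: row_def)

lemma row_pair: "i \<in> I \<Longrightarrow> j \<in> J \<Longrightarrow> k \<in> J \<Longrightarrow> j \<noteq> k \<Longrightarrow> row i {j, k} = p i j \<oplus> p i k"
  by (simp add: row_def entry_closed)

text \<open>Partial sums of a row multiply like indicator functions. Most computations with magic unitaries
below are instances of this.\<close>

lemma row_mult:
  assumes i: "i \<in> I" and S: "S \<subseteq> J" and T: "T \<subseteq> J"
  shows "row i S \<otimes> row i T = row i (S \<inter> T)"
proof -
  have fin: "finite S" "finite T"
    by (rule finite_subset[OF S finite_cols], rule finite_subset[OF T finite_cols])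
  note closed = entry_closed[OF i]
  have entry: "p i j \<otimes> row i T = (if j \<in> T then p i j else \<zero>)" if j: "j \<in> S" for j
  proof -
    have "p i j \<otimes> row i T = (\<Oplus>k\<in>T. p i j \<otimes> p i k)"
      unfolding row_def using fin j S T closed by (intro finsum_rdistr) auto
    also have "\<dots> = (\<Oplus>k\<in>T. if j = k then p i k else \<zero>)"
      using j S T i closed
      by (intro finsum_cong') (auto simp: subset_iff entry_idem row_orthogonal)
    also have "\<dots> = (if j \<in> T then p i j else \<zero>)"
    proof (cases "j \<in> T")
      case True
      then show ?thesis
        using finsum_singleton[OF True fin(2), of "p i"] T closed by auto
    next
      case False
      then have "(\<Oplus>k\<in>T. if j = k then p i k else \<zero>) = (\<Oplus>k\<in>T. \<zero>)"
        by (intro finsum_cong') auto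
      with False show ?thesis by simp
    qed
    finally show ?thesis .
  qed
  have "row i S \<otimes> row i T = (\<Oplus>j\<in>S. p i j \<otimes> row i T)"
    unfolding row_def[of i S] using fin S closed row_closed[OF i T] by (intro finsum_ldistr) auto
  also have "\<dots> = (\<Oplus>j\<in>S. if j \<in> T then p i j else \<zero>)"
    using S closed by (intro finsum_cong') (auto simp: entry)
  also have "\<dots> = row i (S \<inter> T)"
    unfolding row_def using fin S closed by (subst finsum_if) (auto simp: Int_def)
  finally show ?thesis .
qed

lemma row_star:
  assumes i: "i \<in> I" and S: "S \<subseteq> J"
  shows "star A (row i S) = row i S"
proof -
  have closed: "j \<in> S \<Longrightarrow> p i j \<in> carrier A" for j
    using i S entry_closed by blast
  have "star A (row i S) = (\<Oplus>j\<in>S. star A (p i j))"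
    unfolding row_def by (rule finsum_star) (simp add: closed)
  also have "\<dots> = row i S"
    unfolding row_def using S closed by (intro finsum_cong') (auto simp: entry_star[OF i])
  finally show ?thesis .
qed

lemma entry_mult_row:
  assumes "i \<in> I" "j \<in> J" "S \<subseteq> J"
  shows "p i j \<otimes> row i S = (if j \<in> S then p i j else \<zero>)"
    and "row i S \<otimes> p i j = (if j \<in> S then p i j else \<zero>)"
  using row_mult[of i "{j}" S] row_mult[of i S "{j}"] assms by (auto simp: row_single row_empty)

text \<open>Facts about columns are facts about the rows of the transpose.\<close>

lemma magic_unitary_transpose: "magic_unitary A J I (\<lambda>j i. p i j)"
proof unfold_locales
  show "magic_unitary_rels A J I (\<lambda>j i. p i j) \<subseteq> Id"
    unfolding magic_unitary_rels_def
    by (auto simp: entry_star entry_idem row_sum_one col_sum_one row_orthogonal col_orthogonal)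
qed (auto simp: finite_rows finite_cols entry_closed)

lemma transpose_row: "magic_unitary.row A (\<lambda>j i. p i j) = col"
  by (intro ext) (simp add: magic_unitary.row_def[OF magic_unitary_transpose] col_def)

lemma row_sandwich:
  assumes "i \<in> I" "i' \<in> I" "j \<in> J" "j' \<in> J" "S \<subseteq> J"
  shows "p i j \<otimes> (row i S \<otimes> row i' S) \<otimes> p i' j' =
    (if j \<in> S \<and> j' \<in> S then p i j \<otimes> p i' j' else \<zero>)"
proof -
  have "p i j \<otimes> (row i S \<otimes> row i' S) \<otimes> p i' j' = (p i j \<otimes> row i S) \<otimes> (row i' S \<otimes> p i' j')"
    using assms by (simp add: m_assoc entry_closed row_closed)
  then show ?thesis using assms by (simp add: entry_mult_row entry_closed)
qed

text \<open>In the product with an entry of column \<open>j\<close>, the entry of the other row in the same column drops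
out by orthogonality.\<close>

lemma entry_mult_other_row:
  assumes "i \<in> I" "i' \<in> I" "i \<noteq> i'" "j \<in> J" "k \<in> J" "j \<noteq> k"
  shows "p i j \<otimes> row i' {j, k} = p i j \<otimes> p i' k" "row i' {j, k} \<otimes> p i j = p i' k \<otimes> p i j"
  using assms
  by (simp_all add: row_pair r_distr l_distr entry_closed col_orthogonal)

end

lemma magic_unitary_hom:
  assumes A: "magic_unitary A I J p" and B: "star_algebra B" and h: "h \<in> star_alg_hom A B"
    and q: "\<And>i j. i \<in> I \<Longrightarrow> j \<in> J \<Longrightarrow> h (p i j) = q i j"
  shows "magic_unitary B I J q"
proof -
  interpret A: magic_unitary A I J p by (rule A)
  interpret B: star_algebra B by (rule B)
  have "magic_unitary_rels B I J q = map_prod h h ` magic_unitary_rels A I J p"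
    by (rule magic_unitary_rels_hom[OF A.star_algebra_axioms B h A.entry_closed q, symmetric])
  also have "\<dots> \<subseteq> Id" using A.relations by auto
  finally show ?thesis
    using A.finite_rows A.finite_cols star_alg_hom_simps(1)[OF h A.entry_closed] q
    by (unfold_locales) auto
qed

lemma magic_unitary_hom_row:
  assumes A: "magic_unitary A I J p" and B: "magic_unitary B I J q" and h: "h \<in> star_alg_hom A B"
    and q: "\<And>i j. i \<in> I \<Longrightarrow> j \<in> J \<Longrightarrow> h (p i j) = q i j"
    and i: "i \<in> I" and S: "S \<subseteq> J"
  shows "h (magic_unitary.row A p i S) = magic_unitary.row B q i S"
proof -
  interpret A: magic_unitary A I J p by (rule A)
  interpret B: magic_unitary B I J q by (rule B)
  show ?thesis
    unfolding A.row_def B.row_def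
    by (rule star_alg_hom_finsum[OF A.star_algebra_axioms B.star_algebra_axioms h])
      (use i S q A.entry_closed in auto)
qed

section \<open>Magic unitaries between the vertex sets of two graphs\<close>

lemma finite_edges: "simple_graph V E \<Longrightarrow> finite E"
  by (auto simp: simple_graph_def intro: finite_subset[where B = "Pow V"])

lemma edgeE:
  assumes "simple_graph V E" "e \<in> E"
  obtains v w where "e = {v, w}" "v \<noteq> w" "v \<in> V" "w \<in> V"
  using assms by (auto simp: simple_graph_def card_2_iff)

lemma edge_eq_pair:
  assumes "simple_graph V E" "e \<in> E" "v \<in> e" "w \<in> e" "v \<noteq> w"
  shows "e = {v, w}"
  by (rule edgeE[OF assms(1,2)]) (use assms(3-5) in auto)

lemma adjacentD:
  assumes "simple_graph V E" "adjacent E v w"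
  shows "v \<noteq> w" "v \<in> V" "w \<in> V" "{v, w} \<in> E"
  using assms by (auto simp: simple_graph_def adjacent_def)

lemma adjacent_commute: "adjacent E v w \<longleftrightarrow> adjacent E w v"
  by (simp add: adjacent_def insert_commute)

text \<open>A simple graph has at most one edge containing two given distinct vertices, so a sum over the edges
containing both has at most one term.\<close>

lemma (in star_algebra) finsum_edges:
  assumes E: "simple_graph V E" and S: "S \<subseteq> E" and t: "t \<in> carrier A" and neq: "v \<noteq> w"
  shows "(\<Oplus>e\<in>S. if v \<in> e \<and> w \<in> e then t else \<zero>) = (if {v, w} \<in> S then t else \<zero>)"
proof -
  have fin: "finite S" by (rule finite_subset[OF S finite_edges[OF E]])
  have "{e \<in> S. v \<in> e \<and> w \<in> e} = (if {v, w} \<in> S then {{v, w}} else {})"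
    using edge_eq_pair[OF E _ _ _ neq] S by auto
  then show ?thesis using fin t by (subst finsum_if) auto
qed

locale magic_graph_pair = magic_unitary A V1 V2 u for A (structure) and V1 :: "'v set" and V2 :: "'w set" and u +
  fixes E1 :: "'v set set" and E2 :: "'w set set"
  assumes graph1: "simple_graph V1 E1" and graph2: "simple_graph V2 E2"
begin

definition preserves_adjacency :: bool where
  "preserves_adjacency \<longleftrightarrow> (\<forall>v\<in>V1. \<forall>w\<in>V1. \<forall>x\<in>V2. \<forall>y\<in>V2.
     adjacent E1 v w \<noteq> adjacent E2 x y \<longrightarrow> u v x \<otimes> u w y = \<zero>)"

lemma magic_graph_pair_transpose: "magic_graph_pair A V2 V1 (\<lambda>x v. u v x) E2 E1"
  using magic_unitary_transpose graph1 graph2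
  by (intro magic_graph_pair.intro magic_graph_pair_axioms.intro)

text \<open>Between \<open>u v x\<close> and \<open>u w y\<close>, the \<open>(v, y)\<close> entry of \<open>A\<^sub>1 u\<close> becomes \<open>u v x u w y\<close> or zero according to
whether \<open>v \<sim> w\<close>, and that of \<open>u A\<^sub>2\<close> according to whether \<open>x \<sim> y\<close>.\<close>

lemma adjacency_intertwiner_iff:
  "intertwiner_rels A V1 V1 V2 V2 (adjacency_matrix E1) u u (adjacency_matrix E2) \<subseteq> Id
    \<longleftrightarrow> preserves_adjacency"
proof -
  interpret T: magic_unitary A V2 V1 "\<lambda>x v. u v x" by (rule magic_unitary_transpose)
  let ?L = "\<lambda>v y. col y {w \<in> V1. adjacent E1 v w}" and ?R = "\<lambda>v y. row v {x \<in> V2. adjacent E2 x y}"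
  have "(\<Oplus>w\<in>V1. adjacency_matrix E1 v w \<odot> u w y) = ?L v y" if "y \<in> V2" for v y
    using that finite_rows
    by (simp add: adjacency_matrix_def finsum_indicator_smult entry_closed col_def)
  moreover have "(\<Oplus>x\<in>V2. adjacency_matrix E2 x y \<odot> u v x) = ?R v y" if "v \<in> V1" for v y
    using that finite_cols
    by (simp add: adjacency_matrix_def finsum_indicator_smult entry_closed row_def)
  ultimately have "intertwiner_rels A V1 V1 V2 V2 (adjacency_matrix E1) u u (adjacency_matrix E2) \<subseteq> Id
      \<longleftrightarrow> (\<forall>v\<in>V1. \<forall>y\<in>V2. ?L v y = ?R v y)"
    unfolding intertwiner_rels_def by fastforce
  also have "\<dots> \<longleftrightarrow> (\<forall>v\<in>V1. \<forall>y\<in>V2. \<forall>x\<in>V2. \<forall>w\<in>V1.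
      u v x \<otimes> ?L v y \<otimes> u w y = u v x \<otimes> ?R v y \<otimes> u w y)"
  proof (intro ball_cong iffI refl; clarify?)
    fix v y assume vy: "v \<in> V1" "y \<in> V2"
      and eq: "\<forall>x\<in>V2. \<forall>w\<in>V1. u v x \<otimes> ?L v y \<otimes> u w y = u v x \<otimes> ?R v y \<otimes> u w y"
    show "?L v y = ?R v y"
      by (rule sandwich_cancel[OF finite_cols _ row_sum_one[OF vy(1)] finite_rows _ col_sum_one[OF vy(2)]])
        (use vy eq in \<open>auto simp: entry_closed row_closed T.row_closed[unfolded transpose_row]\<close>)
  qed simp
  also have "\<dots> \<longleftrightarrow> (\<forall>v\<in>V1. \<forall>y\<in>V2. \<forall>x\<in>V2. \<forall>w\<in>V1.
      (if adjacent E1 v w then u v x \<otimes> u w y else \<zero>) = (if adjacent E2 x y then u v x \<otimes> u w y else \<zero>))"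
    by (intro ball_cong refl arg_cong2[where f = "(=)"])
      (simp_all add: m_assoc entry_closed row_closed T.row_closed[unfolded transpose_row]
        T.entry_mult_row[unfolded transpose_row] m_assoc[symmetric] entry_mult_row)
  also have "\<dots> \<longleftrightarrow> preserves_adjacency"
    unfolding preserves_adjacency_def by (intro iffI; clarsimp split: if_splits; metis)
  finally show ?thesis .
qed

end

context magic_graph_pair
begin

lemma edge_subset: "e \<in> E1 \<Longrightarrow> e \<subseteq> V1" "f \<in> E2 \<Longrightarrow> f \<subseteq> V2"
  using graph1 graph2 by (auto simp: simple_graph_def)

lemma incidence_intertwiner_iff:
  assumes q: "\<And>e f. e \<in> E1 \<Longrightarrow> f \<in> E2 \<Longrightarrow> q e f \<in> carrier A"
  shows "intertwiner_rels A V1 E1 V2 E2 incidence_matrix q u incidence_matrix \<subseteq> Id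
    \<longleftrightarrow> (\<forall>v\<in>V1. \<forall>f\<in>E2. (\<Oplus>e\<in>{e \<in> E1. v \<in> e}. q e f) = row v f)"
proof -
  have "(\<Oplus>e\<in>E1. incidence_matrix v e \<odot> q e f) = (\<Oplus>e\<in>{e \<in> E1. v \<in> e}. q e f)" if "f \<in> E2" for v f
    using that finite_edges[OF graph1]
    by (simp add: incidence_matrix_def finsum_indicator_smult q)
  moreover have "(\<Oplus>x\<in>V2. incidence_matrix x f \<odot> u v x) = row v f" if "v \<in> V1" "f \<in> E2" for v f
  proof -
    have "{x \<in> V2. x \<in> f} = f" using edge_subset(2)[OF that(2)] by blast
    then show ?thesis
      using that finite_cols
      by (simp add: incidence_matrix_def finsum_indicator_smult entry_closed row_def)
  qed
  ultimately show ?thesis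
    unfolding intertwiner_rels_def by fastforce
qed

lemma row_pair_mult:
  assumes "v \<in> V1" "w \<in> V1" "v \<noteq> w" "x \<in> V2" "y \<in> V2" "x \<noteq> y"
  shows "row v {x, y} \<otimes> row w {x, y} = u v x \<otimes> u w y \<oplus> u v y \<otimes> u w x"
  using assms by (simp add: row_pair l_distr r_distr entry_closed col_orthogonal a_comm)

end

section \<open>From the hypergraph relations to the graph relations\<close>

locale magic_hypergraph_pair = magic_graph_pair A V1 V2 u E1 E2 + edges: magic_unitary A E1 E2 q
  for A (structure) and V1 :: "'v set" and V2 :: "'w set" and u E1 E2 q +
  assumes incidence: "intertwiner_rels A V1 E1 V2 E2 incidence_matrix q u incidence_matrix \<subseteq> Id"
begin

lemma row_eq_edge_col:
  assumes "v \<in> V1" "f \<in> E2"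
  shows "row v f = edges.col f {e \<in> E1. v \<in> e}"
proof -
  have "\<forall>v\<in>V1. \<forall>f\<in>E2. (\<Oplus>e\<in>{e \<in> E1. v \<in> e}. q e f) = row v f"
    by (rule incidence_intertwiner_iff[THEN iffD1, OF edges.entry_closed incidence])
  with assms show ?thesis by (simp add: edges.col_def)
qed

text \<open>Both factors are partial column sums of the edge matrix, over the edges at \<open>v\<close> and at \<open>w\<close>.
Partial sums of a column multiply by intersecting the index sets, and at most one edge contains
both vertices.\<close>

lemma row_mult_row:
  assumes vw: "v \<in> V1" "w \<in> V1" "v \<noteq> w" and f: "f \<in> E2"
  shows "row v f \<otimes> row w f = (if {v, w} \<in> E1 then q {v, w} f else \<zero>)"
proof -
  interpret T: magic_unitary A E2 E1 "\<lambda>f e. q e f" by (rule edges.magic_unitary_transpose)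
  have "row v f \<otimes> row w f = edges.col f ({e \<in> E1. v \<in> e} \<inter> {e \<in> E1. w \<in> e})"
    using vw f by (simp add: row_eq_edge_col T.row_mult[unfolded edges.transpose_row])
  also have "{e \<in> E1. v \<in> e} \<inter> {e \<in> E1. w \<in> e} = (if {v, w} \<in> E1 then {{v, w}} else {})"
    by (auto dest: edge_eq_pair[OF graph1 _ _ _ vw(3)] split: if_splits)
  also have "edges.col f \<dots> = (if {v, w} \<in> E1 then q {v, w} f else \<zero>)"
    using f by (simp add: edges.col_def edges.entry_closed)
  finally show ?thesis .
qed

text \<open>With \<open>a = u v x\<close>, \<open>b = u w y\<close> and \<open>p = row v {x, y} row w {x, y}\<close>, which is symmetric in \<open>v\<close> and \<open>w\<close>
since it is the entry of an edge, one of the two factorisations of \<open>p\<close> gives \<open>a p = a b\<close> and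
\<open>p a = b a\<close>, while the other gives \<open>a b a\<close> in both cases.\<close>

lemma adjacent_entries_commute:
  assumes vw: "adjacent E1 v w" and xy: "adjacent E2 x y"
  shows "u v x \<otimes> u w y = u w y \<otimes> u v x"
proof -
  note vw' = adjacentD[OF graph1 vw] and xy' = adjacentD[OF graph2 xy]
  let ?f = "{x, y}"
  let ?a = "u v x" and ?b = "u w y" and ?p = "row v ?f \<otimes> row w ?f"
  have closed: "?a \<in> carrier A" "?b \<in> carrier A" "row v ?f \<in> carrier A" "row w ?f \<in> carrier A"
    using vw' xy' by (simp_all add: entry_closed row_closed)
  \<comment> \<open>Both orders are the entry of the same edge \<open>{v, w} = {w, v}\<close>.\<close>
  have swap: "row w ?f \<otimes> row v ?f = ?p"
    using vw' xy' row_mult_row[of v w ?f] row_mult_row[of w v ?f] by (simp add: insert_commute)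
  have a: "?a \<otimes> row v ?f = ?a" "row v ?f \<otimes> ?a = ?a"
    "?a \<otimes> row w ?f = ?a \<otimes> ?b" "row w ?f \<otimes> ?a = ?b \<otimes> ?a"
    using vw' xy' by (simp_all add: entry_mult_row entry_mult_other_row)
  have b: "?b \<otimes> row v ?f = ?b \<otimes> ?a" "row v ?f \<otimes> ?b = ?a \<otimes> ?b"
    using vw' xy' entry_mult_other_row[of w v y x] by (simp_all add: insert_commute)
  have "?a \<otimes> ?b = ?a \<otimes> ?p"
    using closed a by (simp add: m_assoc[symmetric])
  also have "\<dots> = ?a \<otimes> ?b \<otimes> ?a"
    using closed a b by (simp add: swap[symmetric] m_assoc[symmetric]) (simp add: m_assoc b)
  also have "\<dots> = ?p \<otimes> ?a"
    using closed a b by (simp add: m_assoc) (simp add: m_assoc[symmetric] b)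
  also have "\<dots> = ?b \<otimes> ?a"
    using closed a by (simp add: swap[symmetric] m_assoc)
  finally show ?thesis .
qed

text \<open>If only \<open>v \<sim> w\<close> holds, inserting \<open>1 = \<Sum>f. q {v, w} f\<close> between \<open>u v x\<close> and \<open>u w y\<close> leaves the terms
for edges \<open>f\<close> containing both \<open>x\<close> and \<open>y\<close>, and there are none. If only \<open>x \<sim> y\<close> holds, then
\<open>row v {x, y} row w {x, y} = 0\<close>, and its compression is the product in question. When \<open>v = w\<close> or
\<open>x = y\<close>, orthogonality suffices.\<close>

lemma adjacency_preserved: preserves_adjacency
  unfolding preserves_adjacency_def
proof (intro ballI impI)
  fix v w x y
  assume in': "v \<in> V1" "w \<in> V1" "x \<in> V2" "y \<in> V2" and neq: "adjacent E1 v w \<noteq> adjacent E2 x y"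
  show "u v x \<otimes> u w y = \<zero>"
  proof (cases "v = w \<or> x = y")
    case True
    then show ?thesis
      using in' neq adjacentD(1)[OF graph1, of v w] adjacentD(1)[OF graph2, of x y]
      by (auto simp: row_orthogonal col_orthogonal)
  next
    case False
    show ?thesis
    proof (cases "adjacent E1 v w")
      case True
      have prod: "u v x \<otimes> q {v, w} f \<otimes> u w y = \<zero>" if f: "f \<in> E2" for f
      proof -
        have "q {v, w} f = row v f \<otimes> row w f"
          using True False in' f by (simp add: row_mult_row adjacent_def)
        moreover have "\<not> (x \<in> f \<and> y \<in> f)"
          using edge_eq_pair[OF graph2 f, of x y] False True neq f by (auto simp: adjacent_def)
        ultimately show ?thesis
          using row_sandwich[OF in' edge_subset(2)[OF f]] by auto
      qed
      have e: "{v, w} \<in> E1" using True by (simp add: adjacent_def)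
      have "u v x \<otimes> u w y = u v x \<otimes> (\<Oplus>f\<in>E2. q {v, w} f) \<otimes> u w y"
        using in' by (simp add: edges.row_sum_one[OF e] entry_closed)
      also have "\<dots> = (\<Oplus>f\<in>E2. u v x \<otimes> q {v, w} f \<otimes> u w y)"
        using in' e finite_edges[OF graph2] by (intro sandwich_sum) (simp_all add: entry_closed edges.entry_closed)
      also have "\<dots> = (\<Oplus>f\<in>E2. \<zero>)"
        by (rule finsum_cong') (simp_all add: prod)
      finally show ?thesis by simp
    next
      case not_adj: False
      then have f: "{x, y} \<in> E2" and e: "{v, w} \<notin> E1"
        using neq by (simp_all add: adjacent_def)
      have "row v {x, y} \<otimes> row w {x, y} = \<zero>"
        using row_mult_row[OF in'(1,2) _ f] False e by simp
      then show ?thesis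
        using row_sandwich[OF in' edge_subset(2)[OF f]] in' by (simp add: entry_closed)
    qed
  qed
qed

end

section \<open>From the graph relations to the hypergraph relations\<close>

context magic_graph_pair
begin

text \<open>An arbitrary ordering of the end points of an edge; any choice gives the same edge matrix
(\<open>edge_entry_eq\<close>).\<close>

definition edge_ends :: "'v set \<Rightarrow> 'v \<times> 'v" where
  "edge_ends e = (SOME (v, w). e = {v, w} \<and> v \<noteq> w)"

definition edge_entry :: "'v set \<Rightarrow> 'w set \<Rightarrow> 'a" where
  "edge_entry e f = row (fst (edge_ends e)) f \<otimes> row (snd (edge_ends e)) f"

end

locale commuting_magic_graph_pair = magic_graph_pair +
  assumes preserves: preserves_adjacency
    and commute: "adjacent E1 v w \<Longrightarrow> adjacent E2 x y \<Longrightarrow> u v x \<otimes> u w y = u w y \<otimes> u v x"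
begin

lemma non_adjacent_zero:
  "v \<in> V1 \<Longrightarrow> w \<in> V1 \<Longrightarrow> x \<in> V2 \<Longrightarrow> y \<in> V2 \<Longrightarrow>
    adjacent E1 v w \<noteq> adjacent E2 x y \<Longrightarrow> u v x \<otimes> u w y = \<zero>"
  using preserves by (simp add: preserves_adjacency_def)

lemma commuting_magic_graph_pair_transpose:
  "commuting_magic_graph_pair A V2 V1 (\<lambda>x v. u v x) E2 E1"
proof -
  interpret T: magic_graph_pair A V2 V1 "\<lambda>x v. u v x" E2 E1 by (rule magic_graph_pair_transpose)
  show ?thesis
    by unfold_locales (auto simp: T.preserves_adjacency_def non_adjacent_zero intro: commute)
qed

text \<open>For \<open>v \<sim> w\<close>, entries \<open>u v x\<close> and \<open>u w y\<close> with \<open>x \<sim> y\<close> commute by hypothesis; for other \<open>x, y\<close> the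
products in both orders vanish.\<close>

lemma rows_commute:
  assumes vw: "adjacent E1 v w" and S: "S \<subseteq> V2" and T: "T \<subseteq> V2"
  shows "row v S \<otimes> row w T = row w T \<otimes> row v S"
proof -
  note vw' = adjacentD[OF graph1 vw]
  have fin: "finite S" "finite T"
    by (rule finite_subset[OF S finite_cols], rule finite_subset[OF T finite_cols])
  have entries: "u v x \<otimes> u w y = u w y \<otimes> u v x" if "x \<in> V2" "y \<in> V2" for x y
  proof (cases "adjacent E2 x y")
    case False
    then have "u v x \<otimes> u w y = \<zero>" "u w y \<otimes> u v x = \<zero>"
      using that vw vw' non_adjacent_zero adjacent_commute[of E1 v w] adjacent_commute[of E2 x y] by auto
    then show ?thesis by simp
  qed (rule commute[OF vw])
  have "u v x \<otimes> row w T = row w T \<otimes> u v x" if "x \<in> V2" for x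
    unfolding row_def using that vw' T fin entries
    by (intro finsum_commute) (auto simp: entry_closed)
  then have "row w T \<otimes> row v S = row v S \<otimes> row w T"
    unfolding row_def[of v] using vw' S T fin row_closed[of w T]
    by (intro finsum_commute) (auto simp: entry_closed)
  then show ?thesis by simp
qed

lemma edge_entry_eq:
  assumes vw: "adjacent E1 v w" and f: "f \<in> E2"
  shows "edge_entry {v, w} f = row v f \<otimes> row w f"
proof -
  obtain a b where ab: "edge_ends {v, w} = (a, b)" by fastforce
  have "case edge_ends {v, w} of (a, b) \<Rightarrow> {v, w} = {a, b} \<and> a \<noteq> b"
    unfolding edge_ends_def
    by (rule someI[where x = "(v, w)"]) (simp add: adjacentD(1)[OF graph1 vw])
  then have "{v, w} = {a, b}" by (simp add: ab)
  then consider "a = v" "b = w" | "a = w" "b = v"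
    by (auto simp: doubleton_eq_iff)
  then show ?thesis
    using rows_commute[OF vw, of f f] edge_subset(2)[OF f]
    by cases (simp_all add: edge_entry_def ab)
qed

text \<open>For \<open>e = {v, w}\<close> and \<open>f = {x, y}\<close> the product of row sums is \<open>u v x u w y + u v y u w x\<close>, that of
column sums is \<open>u v x u w y + u w x u v y\<close>; they differ by the order of two commuting factors.\<close>

lemma edge_entry_transpose:
  assumes e: "e \<in> E1" and f: "f \<in> E2"
  shows "edge_entry e f = magic_graph_pair.edge_entry A (\<lambda>x v. u v x) f e"
proof -
  interpret T: commuting_magic_graph_pair A V2 V1 "\<lambda>x v. u v x" E2 E1
    by (rule commuting_magic_graph_pair_transpose)
  obtain v w where vw: "e = {v, w}" "v \<noteq> w" "v \<in> V1" "w \<in> V1" by (rule edgeE[OF graph1 e])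
  obtain x y where xy: "f = {x, y}" "x \<noteq> y" "x \<in> V2" "y \<in> V2" by (rule edgeE[OF graph2 f])
  have adj: "adjacent E1 v w" "adjacent E2 x y" using e f vw xy by (simp_all add: adjacent_def)
  have "edge_entry e f = u v x \<otimes> u w y \<oplus> u v y \<otimes> u w x"
    using edge_entry_eq[OF adj(1) f] vw xy by (simp add: row_pair_mult)
  also have "u v y \<otimes> u w x = u w x \<otimes> u v y"
    using adj by (intro commute) (simp_all add: adjacent_commute)
  also have "u v x \<otimes> u w y \<oplus> u w x \<otimes> u v y = T.edge_entry f e"
    using T.edge_entry_eq[OF adj(2) e] vw xy by (simp add: T.row_pair_mult)
  finally show ?thesis .
qed

lemma edge_entry_closed:
  assumes e: "e \<in> E1" and f: "f \<in> E2"
  shows "edge_entry e f \<in> carrier A"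
proof (rule edgeE[OF graph1 e])
  fix v w assume "e = {v, w}" "v \<in> V1" "w \<in> V1"
  then show ?thesis
    using e f edge_entry_eq[of v w f] edge_subset(2)[OF f] by (simp add: adjacent_def row_closed)
qed

lemma edge_entry_star:
  assumes e: "e \<in> E1" and f: "f \<in> E2"
  shows "star A (edge_entry e f) = edge_entry e f"
proof (rule edgeE[OF graph1 e])
  fix v w assume "e = {v, w}" "v \<in> V1" "w \<in> V1"
  then show ?thesis
    using e f edge_entry_eq[of v w f] edge_subset(2)[OF f] rows_commute[of v w f f]
    by (simp add: adjacent_def row_closed star_mult row_star)
qed

text \<open>After commuting the middle factors, the product becomes \<open>row v (f \<inter> f') row w (f \<inter> f')\<close>. Distinct edges
share at most one vertex \<open>z\<close>, and \<open>u v z u w z = 0\<close>.\<close>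

lemma edge_entry_mult:
  assumes e: "e \<in> E1" and f: "f \<in> E2" "f' \<in> E2"
  shows "edge_entry e f \<otimes> edge_entry e f' = (if f = f' then edge_entry e f else \<zero>)"
proof -
  obtain v w where vw: "e = {v, w}" "v \<noteq> w" "v \<in> V1" "w \<in> V1" by (rule edgeE[OF graph1 e])
  have adj: "adjacent E1 v w" using e vw by (simp add: adjacent_def)
  note sub = edge_subset(2)[OF f(1)] edge_subset(2)[OF f(2)]
  note closed = row_closed[OF vw(3) sub(1)] row_closed[OF vw(3) sub(2)]
    row_closed[OF vw(4) sub(1)] row_closed[OF vw(4) sub(2)]
  have "edge_entry e f \<otimes> edge_entry e f' = row v f \<otimes> (row w f \<otimes> row v f') \<otimes> row w f'"
    using edge_entry_eq[OF adj] f vw(1) closed by (simp add: m_assoc)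
  also have "row w f \<otimes> row v f' = row v f' \<otimes> row w f"
    using rows_commute[OF adj sub(2,1)] by simp
  also have "row v f \<otimes> (row v f' \<otimes> row w f) \<otimes> row w f' = (row v f \<otimes> row v f') \<otimes> (row w f \<otimes> row w f')"
    using closed by (simp add: m_assoc)
  also have "\<dots> = row v (f \<inter> f') \<otimes> row w (f \<inter> f')"
    using vw sub by (simp add: row_mult)
  also have "\<dots> = (if f = f' then edge_entry e f else \<zero>)"
  proof (cases "f = f'")
    case True
    then show ?thesis using edge_entry_eq[OF adj f(1)] vw(1) by simp
  next
    case False
    obtain x y where xy: "f = {x, y}" "x \<noteq> y" "x \<in> V2" "y \<in> V2" by (rule edgeE[OF graph2 f(1)])
    have "\<not> (x \<in> f' \<and> y \<in> f')"
      using edge_eq_pair[OF graph2 f(2) _ _ xy(2)] False xy(1) by blast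
    then consider "f \<inter> f' = {}" | "f \<inter> f' = {x}" | "f \<inter> f' = {y}"
      using xy(1) by blast
    then have "row v (f \<inter> f') \<otimes> row w (f \<inter> f') = \<zero>"
      using vw xy by cases (simp_all add: row_empty row_single col_orthogonal)
    with False show ?thesis by simp
  qed
  finally show ?thesis .
qed

lemma edge_entry_sandwich:
  assumes vw: "adjacent E1 v w" and f: "f \<in> E2" and x: "x \<in> V2" and y: "y \<in> V2"
  shows "u v x \<otimes> edge_entry {v, w} f \<otimes> u w y = (if x \<in> f \<and> y \<in> f then u v x \<otimes> u w y else \<zero>)"
  using edge_entry_eq[OF vw f] row_sandwich[OF adjacentD(2,3)[OF graph1 vw] x y edge_subset(2)[OF f]]
  by simp

text \<open>Between \<open>u v x\<close> and \<open>u w y\<close> only the term of the edge \<open>{x, y}\<close> survives and gives \<open>u v x u w y\<close>. If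
there is no such edge then \<open>u v x u w y = 0\<close>, so the sum and \<open>1\<close> have the same compressions.\<close>

lemma edge_entry_row_sum:
  assumes e: "e \<in> E1"
  shows "(\<Oplus>f\<in>E2. edge_entry e f) = \<one>"
proof -
  obtain v w where vw: "e = {v, w}" "v \<noteq> w" "v \<in> V1" "w \<in> V1" by (rule edgeE[OF graph1 e])
  have adj: "adjacent E1 v w" using e vw by (simp add: adjacent_def)
  have fin: "finite E2" by (rule finite_edges[OF graph2])
  show ?thesis
  proof (rule sandwich_cancel[OF finite_cols _ row_sum_one[OF vw(3)] finite_cols _ row_sum_one[OF vw(4)]])
    fix x y assume xy: "x \<in> V2" "y \<in> V2"
    have closed: "u v x \<otimes> u w y \<in> carrier A" using vw xy by (simp add: entry_closed)
    have "u v x \<otimes> (\<Oplus>f\<in>E2. edge_entry e f) \<otimes> u w y = (\<Oplus>f\<in>E2. u v x \<otimes> edge_entry e f \<otimes> u w y)"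
      using vw xy fin e by (intro sandwich_sum) (simp_all add: entry_closed edge_entry_closed)
    also have "\<dots> = (\<Oplus>f\<in>E2. if x \<in> f \<and> y \<in> f then u v x \<otimes> u w y else \<zero>)"
      using closed by (intro finsum_cong') (auto simp: vw(1) edge_entry_sandwich[OF adj _ xy])
    also have "\<dots> = u v x \<otimes> u w y"
    proof (cases "x = y")
      case True
      then have "u v x \<otimes> u w y = \<zero>" using vw xy by (simp add: col_orthogonal)
      then show ?thesis by (simp cong: if_cong)
    next
      case False
      then show ?thesis
        using finsum_edges[OF graph2 subset_refl closed False] non_adjacent_zero[OF vw(3,4) xy] adj
        by (auto simp: adjacent_def)
    qed
    finally show "u v x \<otimes> (\<Oplus>f\<in>E2. edge_entry e f) \<otimes> u w y = u v x \<otimes> \<one> \<otimes> u w y"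
      using vw xy by (simp add: entry_closed)
  qed (use vw e in \<open>auto simp: entry_closed edge_entry_closed intro!: finsum_closed\<close>)
qed

text \<open>The sum is compared with \<open>row v f\<close> after multiplication by \<open>u v x\<close> on the left. For \<open>x \<notin> f\<close> both
vanish. For \<open>f = {x, y}\<close> both give \<open>u v x\<close>, which is tested against column \<open>y\<close> on the right:
between \<open>u v x\<close> and \<open>u w y\<close> only the edge \<open>{v, w}\<close> contributes, by the sandwich formula for the
transposed graphs.\<close>

lemma edge_entry_incidence:
  assumes v: "v \<in> V1" and f: "f \<in> E2"
  shows "(\<Oplus>e\<in>{e \<in> E1. v \<in> e}. edge_entry e f) = row v f" (is "?s = _")
proof -
  interpret T: commuting_magic_graph_pair A V2 V1 "\<lambda>x v. u v x" E2 E1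
    by (rule commuting_magic_graph_pair_transpose)
  let ?S = "{e \<in> E1. v \<in> e}"
  have fin: "finite ?S" using finite_edges[OF graph1] by simp
  have s: "?s \<in> carrier A" using f by (intro finsum_closed) (auto simp: edge_entry_closed)
  have entry: "u v x \<otimes> ?s = u v x" if xy: "f = {x, y}" "x \<noteq> y" "x \<in> V2" "y \<in> V2" for x y
  proof -
    have adj: "adjacent E2 x y" using f xy by (simp add: adjacent_def)
    \<comment> \<open>The transposed sandwich formula is available because \<open>x\<close> and \<open>y\<close> are adjacent.\<close>
    have right: "u v x \<otimes> ?s \<otimes> u w y = u v x \<otimes> u w y" if w: "w \<in> V1" for w
    proof -
      have closed: "u v x \<otimes> u w y \<in> carrier A" using v w xy by (simp add: entry_closed)
      have "u v x \<otimes> ?s \<otimes> u w y = (\<Oplus>e\<in>?S. u v x \<otimes> edge_entry e f \<otimes> u w y)"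
        using v w xy fin f by (intro sandwich_sum) (auto simp: entry_closed edge_entry_closed)
      also have "\<dots> = (\<Oplus>e\<in>?S. if v \<in> e \<and> w \<in> e then u v x \<otimes> u w y else \<zero>)"
        using closed f v w
        by (intro finsum_cong')
          (auto simp: edge_entry_transpose xy(1) T.edge_entry_sandwich[OF adj])
      also have "\<dots> = u v x \<otimes> u w y"
      proof (cases "v = w")
        case True
        then have "u v x \<otimes> u w y = \<zero>" using v xy by (simp add: row_orthogonal)
        then show ?thesis by (simp cong: if_cong)
      next
        case False
        then show ?thesis
          using finsum_edges[OF graph1 _ closed False, of ?S] non_adjacent_zero[OF v w xy(3,4)] adj
          by (auto simp: adjacent_def)
      qed
      finally show ?thesis .
    qed
    show ?thesis
      by (rule right_cancel_partition[OF finite_rows _ col_sum_one[OF xy(4)]])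
        (use v xy s right in \<open>simp_all add: entry_closed\<close>)
  qed
  show ?thesis
  proof (rule left_cancel_partition[OF finite_cols _ row_sum_one[OF v]])
    fix x assume x: "x \<in> V2"
    have sub: "f \<subseteq> V2" by (rule edge_subset(2)[OF f])
    show "u v x \<otimes> ?s = u v x \<otimes> row v f"
    proof (cases "x \<in> f")
      case True
      obtain y where y: "f = {x, y}" "x \<noteq> y" "y \<in> V2"
        by (rule edgeE[OF graph2 f]) (use True in auto)
      show ?thesis
        using entry[OF y(1,2) x y(3)] v x sub True by (simp add: entry_mult_row)
    next
      case False
      have "u v x \<otimes> ?s = (\<Oplus>e\<in>?S. u v x \<otimes> edge_entry e f)"
        using v x fin f by (intro finsum_rdistr) (auto simp: entry_closed edge_entry_closed)
      also have "\<dots> = (\<Oplus>e\<in>?S. \<zero>)"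
      proof (rule finsum_cong')
        fix e assume e: "e \<in> ?S"
        then have e': "e \<in> E1" "v \<in> e" by auto
        obtain w where w: "e = {v, w}" "v \<noteq> w" "w \<in> V1"
          by (rule edgeE[OF graph1 e'(1)]) (use e'(2) in auto)
        then have "edge_entry e f = row v f \<otimes> row w f"
          using e f edge_entry_eq[of v w f] by (simp add: adjacent_def)
        then have "u v x \<otimes> edge_entry e f = (u v x \<otimes> row v f) \<otimes> row w f"
          using v x w sub by (simp add: m_assoc entry_closed row_closed)
        then show "u v x \<otimes> edge_entry e f = \<zero>"
          using v x w sub False by (simp add: entry_mult_row row_closed)
      qed auto
      finally show ?thesis
        using v x sub False by (simp add: entry_mult_row)
    qed
  qed (use v f s in \<open>auto simp: entry_closed row_closed[OF v edge_subset(2)[OF f]]\<close>)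
qed

text \<open>The column relations are the row relations of the transpose.\<close>

lemma edge_magic_unitary: "magic_unitary A E1 E2 edge_entry"
proof -
  interpret T: commuting_magic_graph_pair A V2 V1 "\<lambda>x v. u v x" E2 E1
    by (rule commuting_magic_graph_pair_transpose)
  have cols: "(\<Oplus>e\<in>E1. edge_entry e f) = \<one>" if f: "f \<in> E2" for f
  proof -
    have "(\<Oplus>e\<in>E1. edge_entry e f) = (\<Oplus>e\<in>E1. T.edge_entry f e)"
      using f by (intro finsum_cong') (auto simp: edge_entry_transpose T.edge_entry_closed)
    then show ?thesis using T.edge_entry_row_sum[OF f] by simp
  qed
  have col_orth: "edge_entry e f \<otimes> edge_entry e' f = \<zero>" if "e \<in> E1" "e' \<in> E1" "f \<in> E2" "e \<noteq> e'" for e e' f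
    using that T.edge_entry_mult[of f e e'] by (simp add: edge_entry_transpose)
  show ?thesis
  proof unfold_locales
    show "magic_unitary_rels A E1 E2 edge_entry \<subseteq> Id"
      unfolding magic_unitary_rels_def
      by (intro Un_least subsetI;
          clarsimp simp: edge_entry_star edge_entry_mult edge_entry_row_sum cols col_orth)
  qed (auto simp: finite_edges[OF graph1] finite_edges[OF graph2] edge_entry_closed)
qed

lemma magic_hypergraph_pair: "magic_hypergraph_pair A V1 V2 u E1 E2 edge_entry"
proof (intro magic_hypergraph_pair.intro magic_hypergraph_pair_axioms.intro)
  show "intertwiner_rels A V1 E1 V2 E2 incidence_matrix edge_entry u incidence_matrix \<subseteq> Id"
    using incidence_intertwiner_iff[OF edge_entry_closed] edge_entry_incidence by simp
qed (intro magic_graph_pair_axioms edge_magic_unitary)+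

end

section \<open>The algebras of the two games\<close>

lemma iso_rels_carrier:
  "iso_rels V1 E1 V2 E2 \<subseteq>
    carrier (free_star_alg (iso_gens V1 V2)) \<times> carrier (free_star_alg (iso_gens V1 V2))"
proof -
  interpret star_algebra "free_star_alg (iso_gens V1 V2)" by (rule star_algebra_free)
  show ?thesis
    unfolding iso_rels_def Let_def
    by (intro Un_least magic_carrier intertwiner_carrier free_gen_closed) (auto simp: iso_gens_def)
qed

lemma iso_gens_iff: "(v, x) \<in> iso_gens V1 V2 \<longleftrightarrow> v \<in> V1 \<and> x \<in> V2"
  by (simp add: iso_gens_def)

lemma hyp_iso_gens_iff:
  "Inl (v, x) \<in> hyp_iso_gens V1 E1 V2 E2 \<longleftrightarrow> v \<in> V1 \<and> x \<in> V2"
  "Inr (e, f) \<in> hyp_iso_gens V1 E1 V2 E2 \<longleftrightarrow> e \<in> E1 \<and> f \<in> E2"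
  by (auto simp: hyp_iso_gens_def)

lemma hyp_iso_rels_carrier:
  "hyp_iso_rels V1 E1 V2 E2 \<subseteq>
    carrier (free_star_alg (hyp_iso_gens V1 E1 V2 E2)) \<times> carrier (free_star_alg (hyp_iso_gens V1 E1 V2 E2))"
proof -
  interpret star_algebra "free_star_alg (hyp_iso_gens V1 E1 V2 E2)" by (rule star_algebra_free)
  show ?thesis
    unfolding hyp_iso_rels_def Let_def
    by (intro Un_least magic_carrier intertwiner_carrier free_gen_closed) (auto simp: hyp_iso_gens_def)
qed

text \<open>The canonical generators indexed by pairs of edges.\<close>

definition hyp_iso_q :: "'v set \<Rightarrow> 'v set set \<Rightarrow> 'w set \<Rightarrow> 'w set set \<Rightarrow>
    'v set \<Rightarrow> 'w set \<Rightarrow> ('v, 'w) hyp_gen free_elem set" where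
  "hyp_iso_q V1 E1 V2 E2 e f =
     presented_gen (hyp_iso_gens V1 E1 V2 E2) (hyp_iso_rels V1 E1 V2 E2) (Inr (e, f))"

lemma iso_rels_hom:
  assumes B: "star_algebra B" and h: "h \<in> star_alg_hom (free_star_alg (iso_gens V1 V2)) B"
    and u: "\<And>v x. v \<in> V1 \<Longrightarrow> x \<in> V2 \<Longrightarrow> h (free_gen (v, x)) = u v x"
  shows "(\<forall>(a, b)\<in>iso_rels V1 E1 V2 E2. h a = h b) \<longleftrightarrow>
    magic_unitary_rels B V1 V2 u \<subseteq> Id \<and>
    intertwiner_rels B V1 V1 V2 V2 (adjacency_matrix E1) u u (adjacency_matrix E2) \<subseteq> Id"
proof -
  have gen: "v \<in> V1 \<Longrightarrow> x \<in> V2 \<Longrightarrow> free_gen (v, x) \<in> carrier (free_star_alg (iso_gens V1 V2))" for v x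
    by (rule free_gen_closed) (simp add: iso_gens_def)
  have "map_prod h h ` iso_rels V1 E1 V2 E2 = magic_unitary_rels B V1 V2 u
    \<union> intertwiner_rels B V1 V1 V2 V2 (adjacency_matrix E1) u u (adjacency_matrix E2)"
    unfolding iso_rels_def Let_def image_Un
    by (intro arg_cong2[where f = "(\<union>)"] magic_unitary_rels_hom[OF star_algebra_free B h]
        intertwiner_rels_hom[OF star_algebra_free B h]; (rule gen u; assumption))
  then show ?thesis
    unfolding map_prod_subset_Id_iff[symmetric] by simp
qed

lemma hyp_iso_rels_hom:
  assumes B: "star_algebra B" and h: "h \<in> star_alg_hom (free_star_alg (hyp_iso_gens V1 E1 V2 E2)) B"
    and u: "\<And>v x. v \<in> V1 \<Longrightarrow> x \<in> V2 \<Longrightarrow> h (free_gen (Inl (v, x))) = u v x"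
    and q: "\<And>e f. e \<in> E1 \<Longrightarrow> f \<in> E2 \<Longrightarrow> h (free_gen (Inr (e, f))) = q e f"
  shows "(\<forall>(a, b)\<in>hyp_iso_rels V1 E1 V2 E2. h a = h b) \<longleftrightarrow>
    magic_unitary_rels B V1 V2 u \<subseteq> Id \<and> magic_unitary_rels B E1 E2 q \<subseteq> Id \<and>
    intertwiner_rels B V1 E1 V2 E2 incidence_matrix q u incidence_matrix \<subseteq> Id"
proof -
  let ?F = "free_star_alg (hyp_iso_gens V1 E1 V2 E2)"
  have genV: "v \<in> V1 \<Longrightarrow> x \<in> V2 \<Longrightarrow> free_gen (Inl (v, x)) \<in> carrier ?F" for v x
    by (rule free_gen_closed) (auto simp: hyp_iso_gens_def)
  have genE: "e \<in> E1 \<Longrightarrow> f \<in> E2 \<Longrightarrow> free_gen (Inr (e, f)) \<in> carrier ?F" for e f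
    by (rule free_gen_closed) (auto simp: hyp_iso_gens_def)
  have "map_prod h h ` hyp_iso_rels V1 E1 V2 E2 = magic_unitary_rels B V1 V2 u
    \<union> magic_unitary_rels B E1 E2 q
    \<union> intertwiner_rels B V1 E1 V2 E2 incidence_matrix q u incidence_matrix"
    unfolding hyp_iso_rels_def Let_def image_Un
    by (intro arg_cong2[where f = "(\<union>)"] magic_unitary_rels_hom[OF star_algebra_free B h]
        intertwiner_rels_hom[OF star_algebra_free B h]; (rule genV genE u q; assumption))
  then show ?thesis
    unfolding map_prod_subset_Id_iff[symmetric] by simp
qed

text \<open>The universal property of the algebra of the graph isomorphism game, with the adjacency equation
in the form of vanishing products.\<close>

lemma iso_alg_lift:
  assumes B: "magic_graph_pair B V1 V2 u E1 E2"
    and adj: "magic_graph_pair.preserves_adjacency B V1 V2 u E1 E2"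
  obtains k where "k \<in> star_alg_hom (iso_alg V1 E1 V2 E2) B"
    "\<And>v x. v \<in> V1 \<Longrightarrow> x \<in> V2 \<Longrightarrow> k (iso_u V1 E1 V2 E2 v x) = u v x"
proof -
  interpret B: magic_graph_pair B V1 V2 u E1 E2 by (rule B)
  define f where "f = (\<lambda>(v, x). u v x)"
  have closed: "f z \<in> carrier B" if "z \<in> iso_gens V1 V2" for z
    using that B.entry_closed by (auto simp: iso_gens_def f_def)
  have gen: "free_eval B f (free_gen (v, x)) = u v x" if "v \<in> V1" "x \<in> V2" for v x
    using free_eval_hom(2)[of B "iso_gens V1 V2" f "(v, x)", OF B.star_algebra_axioms closed] that
    by (auto simp: iso_gens_def f_def)
  have rel: "\<forall>(a, b)\<in>iso_rels V1 E1 V2 E2. free_eval B f a = free_eval B f b"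
    using iso_rels_hom[OF B.star_algebra_axioms free_eval_hom(1)[OF B.star_algebra_axioms closed] gen]
      B.relations adj B.adjacency_intertwiner_iff by blast
  obtain k where "k \<in> star_alg_hom (presented_star_alg (iso_gens V1 V2) (iso_rels V1 E1 V2 E2)) B"
    "\<And>z. z \<in> iso_gens V1 V2 \<Longrightarrow> k (presented_gen (iso_gens V1 V2) (iso_rels V1 E1 V2 E2) z) = f z"
    by (rule presented_star_alg_lift[where f = f, OF iso_rels_carrier B.star_algebra_axioms closed])
      (use rel in auto)
  then show thesis
    by (intro that[of k]) (auto simp: iso_alg_def iso_u_def iso_gens_def f_def)
qed

lemma hyp_iso_alg_lift:
  assumes B: "magic_hypergraph_pair B V1 V2 u E1 E2 q"
  obtains k where "k \<in> star_alg_hom (hyp_iso_alg V1 E1 V2 E2) B"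
    "\<And>v x. v \<in> V1 \<Longrightarrow> x \<in> V2 \<Longrightarrow> k (hyp_iso_p V1 E1 V2 E2 v x) = u v x"
    "\<And>e f. e \<in> E1 \<Longrightarrow> f \<in> E2 \<Longrightarrow> k (hyp_iso_q V1 E1 V2 E2 e f) = q e f"
proof -
  interpret B: magic_hypergraph_pair B V1 V2 u E1 E2 q by (rule B)
  let ?X = "hyp_iso_gens V1 E1 V2 E2" and ?R = "hyp_iso_rels V1 E1 V2 E2"
  define f where "f = case_sum (\<lambda>(v, x). u v x) (\<lambda>(e, f). q e f)"
  have closed: "f z \<in> carrier B" if "z \<in> ?X" for z
    using that B.entry_closed B.edges.entry_closed by (auto simp: hyp_iso_gens_def f_def)
  have genV: "free_eval B f (free_gen (Inl (v, x))) = u v x" if "v \<in> V1" "x \<in> V2" for v x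
    using free_eval_hom(2)[of B ?X f "Inl (v, x)", OF B.star_algebra_axioms closed] that
    by (auto simp: hyp_iso_gens_def f_def)
  have genE: "free_eval B f (free_gen (Inr (e, g))) = q e g" if "e \<in> E1" "g \<in> E2" for e g
    using free_eval_hom(2)[of B ?X f "Inr (e, g)", OF B.star_algebra_axioms closed] that
    by (auto simp: hyp_iso_gens_def f_def)
  have rel: "\<forall>(a, b)\<in>?R. free_eval B f a = free_eval B f b"
    using hyp_iso_rels_hom[OF B.star_algebra_axioms free_eval_hom(1)[OF B.star_algebra_axioms closed] genV genE]
      B.relations B.edges.relations B.incidence by blast
  obtain k where "k \<in> star_alg_hom (presented_star_alg ?X ?R) B"
    "\<And>z. z \<in> ?X \<Longrightarrow> k (presented_gen ?X ?R z) = f z"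
    by (rule presented_star_alg_lift[where f = f, OF hyp_iso_rels_carrier B.star_algebra_axioms closed])
      (use rel in auto)
  then show thesis
    by (intro that[of k]) (auto simp: hyp_iso_alg_def hyp_iso_p_def hyp_iso_q_def hyp_iso_gens_iff f_def)
qed

lemma iso_alg_magic:
  assumes G: "simple_graph V1 E1" "simple_graph V2 E2"
  shows "magic_graph_pair (iso_alg V1 E1 V2 E2) V1 V2 (iso_u V1 E1 V2 E2) E1 E2"
    and "magic_graph_pair.preserves_adjacency (iso_alg V1 E1 V2 E2) V1 V2 (iso_u V1 E1 V2 E2) E1 E2"
proof -
  let ?A = "iso_alg V1 E1 V2 E2" and ?u = "iso_u V1 E1 V2 E2"
  note A = star_algebra_iso_alg[of V1 E1 V2 E2]
  note proj = presented_star_alg_proj[OF iso_rels_carrier[of V1 E1 V2 E2], folded iso_alg_def]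
  have closed: "?u v x \<in> carrier ?A" if "v \<in> V1" "x \<in> V2" for v x
    unfolding iso_u_def presented_gen_def
    by (rule star_alg_hom_simps(1)[OF proj(1)]) (use that in \<open>auto simp: iso_gens_def intro: free_gen_closed\<close>)
  have rels: "magic_unitary_rels ?A V1 V2 ?u \<subseteq> Id \<and>
    intertwiner_rels ?A V1 V1 V2 V2 (adjacency_matrix E1) ?u ?u (adjacency_matrix E2) \<subseteq> Id"
    by (rule iffD1[OF iso_rels_hom[OF A proj(1)]])
      (auto simp: iso_u_def presented_gen_def dest: proj(2))
  show pair: "magic_graph_pair ?A V1 V2 ?u E1 E2"
    using A closed rels G
    by (intro magic_graph_pair.intro magic_unitary.intro magic_unitary_axioms.intro magic_graph_pair_axioms.intro)
      (auto simp: simple_graph_def)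
  show "magic_graph_pair.preserves_adjacency ?A V1 V2 ?u E1 E2"
    using rels magic_graph_pair.adjacency_intertwiner_iff[OF pair] by blast
qed

lemma hyp_iso_alg_magic:
  assumes G: "simple_graph V1 E1" "simple_graph V2 E2"
  shows "magic_hypergraph_pair (hyp_iso_alg V1 E1 V2 E2) V1 V2 (hyp_iso_p V1 E1 V2 E2) E1 E2
    (hyp_iso_q V1 E1 V2 E2)"
proof -
  let ?A = "hyp_iso_alg V1 E1 V2 E2" and ?p = "hyp_iso_p V1 E1 V2 E2" and ?q = "hyp_iso_q V1 E1 V2 E2"
  note A = star_algebra_hyp_iso_alg[of V1 E1 V2 E2]
  note proj = presented_star_alg_proj[OF hyp_iso_rels_carrier[of V1 E1 V2 E2], folded hyp_iso_alg_def]
  have closedV: "?p v x \<in> carrier ?A" if "v \<in> V1" "x \<in> V2" for v x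
    unfolding hyp_iso_p_def presented_gen_def
    by (rule star_alg_hom_simps(1)[OF proj(1)])
      (use that in \<open>auto simp: hyp_iso_gens_def intro: free_gen_closed\<close>)
  have closedE: "?q e f \<in> carrier ?A" if "e \<in> E1" "f \<in> E2" for e f
    unfolding hyp_iso_q_def presented_gen_def
    by (rule star_alg_hom_simps(1)[OF proj(1)])
      (use that in \<open>auto simp: hyp_iso_gens_def intro: free_gen_closed\<close>)
  have rels: "magic_unitary_rels ?A V1 V2 ?p \<subseteq> Id \<and> magic_unitary_rels ?A E1 E2 ?q \<subseteq> Id \<and>
    intertwiner_rels ?A V1 E1 V2 E2 incidence_matrix ?q ?p incidence_matrix \<subseteq> Id"
    by (rule iffD1[OF hyp_iso_rels_hom[OF A proj(1)]])
      (auto simp: hyp_iso_p_def hyp_iso_q_def presented_gen_def dest: proj(2))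
  show ?thesis
    using A closedV closedE rels G finite_edges[OF G(1)] finite_edges[OF G(2)]
    by (intro magic_hypergraph_pair.intro magic_hypergraph_pair_axioms.intro magic_graph_pair.intro
        magic_unitary.intro magic_unitary_axioms.intro magic_graph_pair_axioms.intro)
      (auto simp: simple_graph_def)
qed

lemma edge_commutators_carrier:
  assumes G: "simple_graph V1 E1" "simple_graph V2 E2"
  shows "edge_commutators V1 E1 V2 E2 \<subseteq> carrier (iso_alg V1 E1 V2 E2)"
proof -
  interpret A: magic_graph_pair "iso_alg V1 E1 V2 E2" V1 V2 "iso_u V1 E1 V2 E2" E1 E2
    by (rule iso_alg_magic(1)[OF G])
  show ?thesis
    using adjacentD(2,3)[OF G(1)] adjacentD(2,3)[OF G(2)]
    by (auto simp: edge_commutators_def Let_def intro!: A.minus_closed A.m_closed A.entry_closed)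
qed

theorem proposition3p10:
  fixes V1 :: "'v set" and E1 :: "'v set set"
    and V2 :: "'w set" and E2 :: "'w set set"
  assumes "simple_graph V1 E1" and "simple_graph V2 E2"
  shows "let A = iso_alg V1 E1 V2 E2;
             J = star_idl A (edge_commutators V1 E1 V2 E2)
         in \<exists>\<phi> \<in> star_alg_iso (hyp_iso_alg V1 E1 V2 E2) (star_quot A J).
              \<forall>v1\<in>V1. \<forall>v2\<in>V2.
                \<phi> (hyp_iso_p V1 E1 V2 E2 v1 v2) = J +>\<^bsub>A\<^esub> iso_u V1 E1 V2 E2 v1 v2"
proof -
  let ?H = "hyp_iso_alg V1 E1 V2 E2" and ?p = "hyp_iso_p V1 E1 V2 E2" and ?q = "hyp_iso_q V1 E1 V2 E2"
  let ?A = "iso_alg V1 E1 V2 E2" and ?u = "iso_u V1 E1 V2 E2"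
  let ?C = "edge_commutators V1 E1 V2 E2"
  define J where "J = star_idl ?A ?C"
  define Q where "Q = star_quot ?A J"
  define \<pi> where "\<pi> x = J +>\<^bsub>?A\<^esub> x" for x
  define u' where "u' v x = \<pi> (?u v x)" for v x
  interpret A: magic_graph_pair ?A V1 V2 ?u E1 E2 by (rule iso_alg_magic(1)[OF assms])
  interpret H: magic_hypergraph_pair ?H V1 V2 ?p E1 E2 ?q by (rule hyp_iso_alg_magic[OF assms])
  note A = A.star_algebra_axioms and H = H.star_algebra_axioms
  note C = edge_commutators_carrier[OF assms]
  have J: "star_ideal J ?A" "?C \<subseteq> J"
    unfolding J_def by (rule A.star_ideal_star_idl[OF C])+
  interpret J: ideal J ?A using J(1) by (simp add: star_ideal_def)
  have Q: "star_algebra Q" unfolding Q_def by (rule A.star_algebra_star_quot[OF J(1)])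
  have \<pi>: "\<pi> \<in> star_alg_hom ?A Q"
    unfolding \<pi>_def Q_def by (rule star_quot_proj[OF A J(1)])
  have magicQ: "magic_unitary Q V1 V2 u'"
    by (rule magic_unitary_hom[OF A.magic_unitary_axioms Q \<pi>]) (simp add: u'_def)
  interpret Q: magic_graph_pair Q V1 V2 u' E1 E2
    using magicQ assms by (intro magic_graph_pair.intro magic_graph_pair_axioms.intro)
  interpret Q: commuting_magic_graph_pair Q V1 V2 u' E1 E2
  proof unfold_locales
    show Q.preserves_adjacency
      unfolding Q.preserves_adjacency_def
    proof (intro ballI impI)
      fix v w x y
      assume in': "v \<in> V1" "w \<in> V1" "x \<in> V2" "y \<in> V2" and neq: "adjacent E1 v w \<noteq> adjacent E2 x y"
      have "u' v x \<otimes>\<^bsub>Q\<^esub> u' w y = \<pi> (?u v x \<otimes>\<^bsub>?A\<^esub> ?u w y)"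
        using in' by (simp add: u'_def star_alg_hom_simps(2)[OF \<pi>] A.entry_closed)
      also have "?u v x \<otimes>\<^bsub>?A\<^esub> ?u w y = \<zero>\<^bsub>?A\<^esub>"
        using iso_alg_magic(2)[OF assms] in' neq by (simp add: A.preserves_adjacency_def)
      finally show "u' v x \<otimes>\<^bsub>Q\<^esub> u' w y = \<zero>\<^bsub>Q\<^esub>"
        by (simp add: star_alg_hom_zero[OF A Q \<pi>])
    qed
    fix v w x y
    assume adj: "adjacent E1 v w" "adjacent E2 x y"
    note in' = adjacentD(2,3)[OF assms(1) adj(1)] adjacentD(2,3)[OF assms(2) adj(2)]
    let ?a = "?u v x \<otimes>\<^bsub>?A\<^esub> ?u w y" and ?b = "?u w y \<otimes>\<^bsub>?A\<^esub> ?u v x"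
    have "?a \<ominus>\<^bsub>?A\<^esub> ?b \<in> ?C"
      using adj unfolding edge_commutators_def Let_def by blast
    then have "?a \<ominus>\<^bsub>?A\<^esub> ?b \<in> J" using J(2) by blast
    then have "\<pi> ?a = \<pi> ?b"
      unfolding \<pi>_def using in' A.quotient_eq_iff_same_a_r_cos[OF J.ideal_axioms, of ?a ?b]
      by (simp add: A.entry_closed)
    then show "u' v x \<otimes>\<^bsub>Q\<^esub> u' w y = u' w y \<otimes>\<^bsub>Q\<^esub> u' v x"
      using in' by (simp add: u'_def star_alg_hom_simps(2)[OF \<pi>] A.entry_closed)
  qed
  obtain \<phi> where \<phi>: "\<phi> \<in> star_alg_hom ?H Q"
    and \<phi>_p: "\<And>v x. v \<in> V1 \<Longrightarrow> x \<in> V2 \<Longrightarrow> \<phi> (?p v x) = u' v x"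
    and \<phi>_q: "\<And>e f. e \<in> E1 \<Longrightarrow> f \<in> E2 \<Longrightarrow> \<phi> (?q e f) = Q.edge_entry e f"
    using hyp_iso_alg_lift[OF Q.magic_hypergraph_pair] by blast
  \<comment> \<open>The inverse is built first on the algebra of the graph game and then passed to the quotient.\<close>
  obtain \<psi>\<^sub>0 where \<psi>\<^sub>0: "\<psi>\<^sub>0 \<in> star_alg_hom ?A ?H"
    and \<psi>\<^sub>0_u: "\<And>v x. v \<in> V1 \<Longrightarrow> x \<in> V2 \<Longrightarrow> \<psi>\<^sub>0 (?u v x) = ?p v x"
    using iso_alg_lift[OF H.magic_graph_pair_axioms H.adjacency_preserved] by blast
  have "\<psi>\<^sub>0 c = \<zero>\<^bsub>?H\<^esub>" if c: "c \<in> ?C" for c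
  proof -
    obtain v w x y where adj: "adjacent E1 v w" "adjacent E2 x y"
      and c_eq: "c = ?u v x \<otimes>\<^bsub>?A\<^esub> ?u w y \<ominus>\<^bsub>?A\<^esub> ?u w y \<otimes>\<^bsub>?A\<^esub> ?u v x"
      using c unfolding edge_commutators_def Let_def by blast
    note in' = adjacentD(2,3)[OF assms(1) adj(1)] adjacentD(2,3)[OF assms(2) adj(2)]
    have "\<psi>\<^sub>0 c = ?p v x \<otimes>\<^bsub>?H\<^esub> ?p w y \<ominus>\<^bsub>?H\<^esub> ?p w y \<otimes>\<^bsub>?H\<^esub> ?p v x"
      using in' by (simp add: c_eq star_alg_hom_minus[OF A H \<psi>\<^sub>0] star_alg_hom_simps(2)[OF \<psi>\<^sub>0] \<psi>\<^sub>0_u A.entry_closed)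
    also have "\<dots> = \<zero>\<^bsub>?H\<^esub>"
      using in' by (simp add: H.adjacent_entries_commute[OF adj] H.minus_eq H.r_neg H.entry_closed)
    finally show ?thesis .
  qed
  then obtain \<psi> where \<psi>: "\<psi> \<in> star_alg_hom Q ?H"
    and \<psi>_\<pi>: "\<And>x. x \<in> carrier ?A \<Longrightarrow> \<psi> (\<pi> x) = \<psi>\<^sub>0 x"
    using star_quot_lift[OF A H \<psi>\<^sub>0 C] unfolding Q_def J_def \<pi>_def by blast
  have \<psi>_u: "\<psi> (u' v x) = ?p v x" if "v \<in> V1" "x \<in> V2" for v x
    using that by (simp add: u'_def \<psi>_\<pi> \<psi>\<^sub>0_u A.entry_closed)
  \<comment> \<open>The edge generators return to themselves, because in the hypergraph algebra too they are
    products of row sums.\<close>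
  have \<psi>_q: "\<psi> (Q.edge_entry e f) = ?q e f" if e: "e \<in> E1" and f: "f \<in> E2" for e f
  proof -
    obtain v w where vw: "e = {v, w}" "v \<noteq> w" "v \<in> V1" "w \<in> V1" by (rule edgeE[OF assms(1) e])
    have sub: "f \<subseteq> V2" by (rule Q.edge_subset(2)[OF f])
    have "\<psi> (Q.edge_entry e f) = \<psi> (Q.row v f \<otimes>\<^bsub>Q\<^esub> Q.row w f)"
      using e f vw by (simp add: Q.edge_entry_eq adjacent_def)
    also have "\<dots> = H.row v f \<otimes>\<^bsub>?H\<^esub> H.row w f"
      using vw sub by (simp add: star_alg_hom_simps(2)[OF \<psi>] Q.row_closed
          magic_unitary_hom_row[OF magicQ H.magic_unitary_axioms \<psi> \<psi>_u])
    also have "\<dots> = ?q e f"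
      using e f vw by (simp add: H.row_mult_row)
    finally show ?thesis .
  qed
  have \<psi>\<phi>: "\<psi> (\<phi> y) = y" if y: "y \<in> carrier ?H" for y
  proof -
    have "(\<psi> \<circ> \<phi>) y = id y"
    proof (rule presented_hom_eqI[OF hyp_iso_rels_carrier, folded hyp_iso_alg_def, OF H _ star_alg_hom_id _ y])
      show "\<psi> \<circ> \<phi> \<in> star_alg_hom ?H ?H" by (rule star_alg_hom_compose[OF \<phi> \<psi>])
      fix z assume "z \<in> hyp_iso_gens V1 E1 V2 E2"
      then show "(\<psi> \<circ> \<phi>) (presented_gen (hyp_iso_gens V1 E1 V2 E2) (hyp_iso_rels V1 E1 V2 E2) z) =
          id (presented_gen (hyp_iso_gens V1 E1 V2 E2) (hyp_iso_rels V1 E1 V2 E2) z)"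
        using \<phi>_p \<phi>_q \<psi>_u \<psi>_q
        by (cases z) (auto simp: hyp_iso_gens_iff hyp_iso_p_def[symmetric] hyp_iso_q_def[symmetric])
    qed
    then show ?thesis by simp
  qed
  have \<phi>\<psi>: "\<phi> (\<psi> y) = y" if y: "y \<in> carrier Q" for y
  proof -
    obtain a where a: "a \<in> carrier ?A" "y = \<pi> a"
      using y star_quot_carrierD unfolding Q_def \<pi>_def by blast
    have "(\<phi> \<circ> \<psi> \<circ> \<pi>) a = \<pi> a"
    proof (rule presented_hom_eqI[OF iso_rels_carrier, folded iso_alg_def, OF Q _ \<pi> _ a(1)])
      show "\<phi> \<circ> \<psi> \<circ> \<pi> \<in> star_alg_hom ?A Q"
        by (intro star_alg_hom_compose[OF \<pi>] star_alg_hom_compose[OF \<psi> \<phi>])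
      fix z assume "z \<in> iso_gens V1 V2"
      then show "(\<phi> \<circ> \<psi> \<circ> \<pi>) (presented_gen (iso_gens V1 V2) (iso_rels V1 E1 V2 E2) z) =
          \<pi> (presented_gen (iso_gens V1 V2) (iso_rels V1 E1 V2 E2) z)"
        using \<psi>_u \<phi>_p
        by (cases z) (auto simp: iso_gens_iff iso_u_def[symmetric] u'_def)
    qed
    then show ?thesis using a(2) by simp
  qed
  have "\<phi> \<in> star_alg_iso ?H Q"
    by (rule inverse_homs_star_alg_iso[OF \<phi> \<psi> \<psi>\<phi> \<phi>\<psi>])
  moreover have "\<forall>v\<in>V1. \<forall>x\<in>V2. \<phi> (?p v x) = J +>\<^bsub>?A\<^esub> ?u v x"
    using \<phi>_p by (simp add: u'_def \<pi>_def)
  ultimately show ?thesis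
    unfolding Let_def J_def[symmetric] Q_def by blast
qed

end
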